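(* Let $V$ be a real vector space of dimension $n\ge 2$, let $h$ be a non-degenerate symmetric inner product on $V$ (of arbitrary signature), and let $A\in\mathfrak{W}(V)$ be a Weyl generalized curvature tensor, i.e. let $(V,h,A)$ be a Weyl curvature model. Then $(V,h,A)$ is geometrically realized by a Weyl manifold: there exist a Weyl manifold $(N,g,\nabla)$, a point $P\in N$, and a linear isomorphism $\Xi:V\to T_PN$ such that $\Xi^*g_P=h$ and $\Xi^*R_P=A$, where $R$ is the $g$-associated curvature tensor of $\nabla$.
   Context: Weyl manifold: a triple $(N,g,\nabla)$ where $N$ is a smooth $n$-dimensional manifold ($n\ge2$), $g$ is a pseudo-Riemannian metric on $N$, and $\nabla$ is a torsion free connection on $TN$ such that $\nabla g=-2\phi\otimes g$ for some smooth $1$-form $\phi$ on $N$, i.e. $(\nabla_x g)(y,z)=-2\phi(x)g(y,z)$. Curvature of $\nabla$: $\mathcal{R}(x,y)z:=(\nabla_x\nabla_y-\nabla_y\nabla_x-\nabla_{[x,y]})z$, and the $g$-associated curvature tensor is $R(x,y,z,w):=g(\mathcal{R}(x,y)z,w)$. Algebraic setting: for $A\in\otimes^4V^*$, let $\operatorname{Ric}(x,y):=\sum_{i,l}h^{il}A(e_i,x,y,e_l)$, where $\{e_i\}$ is any basis of $V$ and $(h^{il})$ is the inverse of the matrix $(h(e_i,e_l))$. The space $\mathfrak{W}(V)$ of Weyl generalized curvature tensors (relative to $h$) consists of all $A\in\otimes^4V^*$ such that for all $x,y,z,w\in V$: (i) $A(x,y,z,w)+A(y,x,z,w)=0$; (ii)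 $A(x,y,z,w)+A(y,z,x,w)+A(z,x,y,w)=0$; (iii) $A(x,y,z,w)+A(x,y,w,z)=\frac2n\{\operatorname{Ric}(y,x)-\operatorname{Ric}(x,y)\}h(z,w)$. *)

theory Defs
  imports "HOL-Analysis.Analysis"
begin

section \<open>Weyl generalized curvature tensors\<close>

definition is_basis :: "'v::real_vector set \<Rightarrow> bool" where
  "is_basis B \<longleftrightarrow> independent B \<and> span B = UNIV"

definition is_inner_product :: "('v::real_vector \<Rightarrow> 'v \<Rightarrow> real) \<Rightarrow> bool" where
  "is_inner_product h \<longleftrightarrow>
     bilinear h \<and> (\<forall>x y. h x y = h y x) \<and> (\<forall>x. (\<forall>y. h x y = 0) \<longrightarrow> x = 0)"

definition multilinear4 ::
  "('v::real_vector \<Rightarrow> 'v \<Rightarrow> 'v \<Rightarrow> 'v \<Rightarrow> real) \<Rightarrow> bool" where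
  "multilinear4 A \<longleftrightarrow>
     (\<forall>y z w. linear (\<lambda>x. A x y z w)) \<and> (\<forall>x z w. linear (\<lambda>y. A x y z w)) \<and>
     (\<forall>x y w. linear (\<lambda>z. A x y z w)) \<and> (\<forall>x y z. linear (\<lambda>w. A x y z w))"

text \<open>The inverse of the Gram matrix of \<open>h\<close>, with rows and columns indexed by the vectors
  of the basis \<open>B\<close>; the entries outside \<open>B \<times> B\<close> are fixed to be zero.\<close>

definition gram_inverse ::
  "('v::real_vector \<Rightarrow> 'v \<Rightarrow> real) \<Rightarrow> 'v set \<Rightarrow> 'v \<Rightarrow> 'v \<Rightarrow> real" where
  "gram_inverse h B = (THE K.
     (\<forall>i l. (i \<notin> B \<or> l \<notin> B) \<longrightarrow> K i l = 0) \<and>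
     (\<forall>i\<in>B. \<forall>k\<in>B. (\<Sum>l\<in>B. h i l * K l k) = (if i = k then 1 else 0)) \<and>
     (\<forall>i\<in>B. \<forall>k\<in>B. (\<Sum>l\<in>B. K i l * h l k) = (if i = k then 1 else 0)))"

text \<open>The trace does not depend on the basis, so an arbitrary one is chosen.\<close>

definition ricci ::
  "('v::real_vector \<Rightarrow> 'v \<Rightarrow> real) \<Rightarrow> ('v \<Rightarrow> 'v \<Rightarrow> 'v \<Rightarrow> 'v \<Rightarrow> real) \<Rightarrow> 'v \<Rightarrow> 'v \<Rightarrow> real" where
  "ricci h A x y =
     (let B = (SOME B. is_basis B) in \<Sum>i\<in>B. \<Sum>l\<in>B. gram_inverse h B i l * A i x y l)"

definition weyl_curvature_tensors ::
  "('v::real_vector \<Rightarrow> 'v \<Rightarrow> real) \<Rightarrow> ('v \<Rightarrow> 'v \<Rightarrow> 'v \<Rightarrow> 'v \<Rightarrow> real) set" where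
  "weyl_curvature_tensors h = {A. multilinear4 A \<and>
     (\<forall>x y z w. A x y z w + A y x z w = 0) \<and>
     (\<forall>x y z w. A x y z w + A y z x w + A z x y w = 0) \<and>
     (\<forall>x y z w. A x y z w + A x y w z =
        2 / real (dim (UNIV :: 'v set)) * (ricci h A y x - ricci h A x y) * h z w)}"


section \<open>Smooth manifolds\<close>

text \<open>A function is smooth on an open set if all iterated directional derivatives exist
  and are continuous there; the set is always open in what follows.\<close>

primrec Ck_on ::
  "nat \<Rightarrow> 'a::real_normed_vector set \<Rightarrow> ('a \<Rightarrow> 'b::real_normed_vector) \<Rightarrow> bool" where
  "Ck_on 0 S f \<longleftrightarrow> continuous_on S f"
| "Ck_on (Suc k) S f \<longleftrightarrow>
     (\<forall>x\<in>S. f differentiable (at x)) \<and> (\<forall>v. Ck_on k S (\<lambda>x. frechet_derivative f (at x) v))"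

definition smooth_on ::
  "'a::real_normed_vector set \<Rightarrow> ('a \<Rightarrow> 'b::real_normed_vector) \<Rightarrow> bool" where
  "smooth_on S f \<longleftrightarrow> (\<forall>k. Ck_on k S f)"

text \<open>A chart is a pair of its domain and its coordinate map; values of the coordinate map
  outside the domain are irrelevant.\<close>

type_synonym ('m, 'n) chart = "'m set \<times> ('m \<Rightarrow> real ^ 'n)"

definition chart_inv :: "('m, 'n) chart \<Rightarrow> real ^ 'n \<Rightarrow> 'm" where
  "chart_inv c = inv_into (fst c) (snd c)"

definition points :: "('m, 'n) chart set \<Rightarrow> 'm set" where
  "points \<A> = \<Union>(fst ` \<A>)"

definition charts_at :: "('m, 'n) chart set \<Rightarrow> 'm \<Rightarrow> ('m, 'n) chart set" where
  "charts_at \<A> p = {c \<in> \<A>. p \<in> fst c}"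

definition smooth_manifold :: "'m topology \<Rightarrow> ('m, 'n::finite) chart set \<Rightarrow> bool" where
  "smooth_manifold T \<A> \<longleftrightarrow>
     Hausdorff_space T \<and> second_countable T \<and> topspace T = points \<A> \<and>
     (\<forall>c\<in>\<A>. openin T (fst c) \<and> open (snd c ` fst c) \<and>
        homeomorphic_map (subtopology T (fst c)) (top_of_set (snd c ` fst c)) (snd c)) \<and>
     (\<forall>c\<in>\<A>. \<forall>d\<in>\<A>. smooth_on (snd c ` (fst c \<inter> fst d)) (snd d \<circ> chart_inv c))"

definition smooth_functions :: "('m, 'n::finite) chart set \<Rightarrow> ('m \<Rightarrow> real) set" where
  "smooth_functions \<A> = {f. \<forall>c\<in>\<A>. smooth_on (snd c ` fst c) (f \<circ> chart_inv c)}"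

text \<open>A tangent vector at \<open>p\<close> is the family of its coordinate vectors in all charts around
  \<open>p\<close>, related by the derivatives of the transition maps. Families are extended by zero to all
  other charts, so that the tangent space is a vector space under the pointwise operations; it is
  trivial if \<open>p\<close> is not a point of the manifold.\<close>

type_synonym ('m, 'n) tvec = "('m, 'n) chart \<Rightarrow> real ^ 'n"

definition tangent_space :: "('m, 'n::finite) chart set \<Rightarrow> 'm \<Rightarrow> ('m, 'n) tvec set" where
  "tangent_space \<A> p = {v.
     (\<forall>c. c \<notin> charts_at \<A> p \<longrightarrow> v c = 0) \<and>
     (\<forall>c\<in>charts_at \<A> p. \<forall>d\<in>charts_at \<A> p.
        v d = frechet_derivative (snd d \<circ> chart_inv c) (at (snd c p)) (v c))}"

definition tv_add :: "('m, 'n::finite) tvec \<Rightarrow> ('m, 'n) tvec \<Rightarrow> ('m, 'n) tvec" where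
  "tv_add u v = (\<lambda>c. u c + v c)"

definition tv_diff :: "('m, 'n::finite) tvec \<Rightarrow> ('m, 'n) tvec \<Rightarrow> ('m, 'n) tvec" where
  "tv_diff u v = (\<lambda>c. u c - v c)"

definition tv_scale :: "real \<Rightarrow> ('m, 'n::finite) tvec \<Rightarrow> ('m, 'n) tvec" where
  "tv_scale a u = (\<lambda>c. a *\<^sub>R u c)"

type_synonym ('m, 'n) vfield = "'m \<Rightarrow> ('m, 'n) tvec"

definition vector_fields :: "('m, 'n::finite) chart set \<Rightarrow> ('m, 'n) vfield set" where
  "vector_fields \<A> = {X.
     (\<forall>p. X p \<in> tangent_space \<A> p) \<and>
     (\<forall>c\<in>\<A>. smooth_on (snd c ` fst c) (\<lambda>x. X (chart_inv c x) c))}"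

definition vf_add :: "('m, 'n::finite) vfield \<Rightarrow> ('m, 'n) vfield \<Rightarrow> ('m, 'n) vfield" where
  "vf_add X Y = (\<lambda>p. tv_add (X p) (Y p))"

definition vf_diff :: "('m, 'n::finite) vfield \<Rightarrow> ('m, 'n) vfield \<Rightarrow> ('m, 'n) vfield" where
  "vf_diff X Y = (\<lambda>p. tv_diff (X p) (Y p))"

definition vf_scale :: "('m \<Rightarrow> real) \<Rightarrow> ('m, 'n::finite) vfield \<Rightarrow> ('m, 'n) vfield" where
  "vf_scale f X = (\<lambda>p. tv_scale (f p) (X p))"

text \<open>The derivative of a function along a vector field; by the chain rule every chart around
  the point gives the same value.\<close>

definition vf_deriv ::
  "('m, 'n::finite) chart set \<Rightarrow> ('m, 'n) vfield \<Rightarrow> ('m \<Rightarrow> real) \<Rightarrow> 'm \<Rightarrow> real" where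
  "vf_deriv \<A> X f p =
     (let c = (SOME c. c \<in> charts_at \<A> p)
      in frechet_derivative (f \<circ> chart_inv c) (at (snd c p)) (X p c))"

text \<open>In coordinates, \<open>[X, Y]\<^sup>i = X\<^sup>j \<partial>\<^sub>j Y\<^sup>i - Y\<^sup>j \<partial>\<^sub>j X\<^sup>i\<close>.\<close>

definition lie_bracket ::
  "('m, 'n::finite) chart set \<Rightarrow> ('m, 'n) vfield \<Rightarrow> ('m, 'n) vfield \<Rightarrow> ('m, 'n) vfield" where
  "lie_bracket \<A> X Y = (\<lambda>p c.
     if c \<in> charts_at \<A> p then
       frechet_derivative (\<lambda>x. Y (chart_inv c x) c) (at (snd c p)) (X p c) -
       frechet_derivative (\<lambda>x. X (chart_inv c x) c) (at (snd c p)) (Y p c)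
     else 0)"


section \<open>Weyl manifolds\<close>

definition one_form ::
  "('m, 'n::finite) chart set \<Rightarrow> ('m \<Rightarrow> ('m, 'n) tvec \<Rightarrow> real) \<Rightarrow> bool" where
  "one_form \<A> \<phi> \<longleftrightarrow>
     (\<forall>p\<in>points \<A>. \<forall>u\<in>tangent_space \<A> p. \<forall>v\<in>tangent_space \<A> p. \<forall>a.
        \<phi> p (tv_add u v) = \<phi> p u + \<phi> p v \<and> \<phi> p (tv_scale a u) = a * \<phi> p u) \<and>
     (\<forall>X\<in>vector_fields \<A>. (\<lambda>p. \<phi> p (X p)) \<in> smooth_functions \<A>)"

definition pseudo_riemannian_metric ::
  "('m, 'n::finite) chart set \<Rightarrow> ('m \<Rightarrow> ('m, 'n) tvec \<Rightarrow> ('m, 'n) tvec \<Rightarrow> real) \<Rightarrow> bool" where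
  "pseudo_riemannian_metric \<A> g \<longleftrightarrow>
     (\<forall>p\<in>points \<A>. \<forall>u\<in>tangent_space \<A> p.
        (\<forall>v\<in>tangent_space \<A> p. g p u v = g p v u) \<and>
        (\<forall>v\<in>tangent_space \<A> p. \<forall>w\<in>tangent_space \<A> p. \<forall>a.
           g p (tv_add u v) w = g p u w + g p v w \<and> g p (tv_scale a u) w = a * g p u w) \<and>
        ((\<forall>v\<in>tangent_space \<A> p. g p u v = 0) \<longrightarrow> u = (\<lambda>c. 0))) \<and>
     (\<forall>X\<in>vector_fields \<A>. \<forall>Y\<in>vector_fields \<A>.
        (\<lambda>p. g p (X p) (Y p)) \<in> smooth_functions \<A>)"

definition connection ::
  "('m, 'n::finite) chart set \<Rightarrow> (('m, 'n) vfield \<Rightarrow> ('m, 'n) vfield \<Rightarrow> ('m, 'n) vfield) \<Rightarrow> bool" where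
  "connection \<A> D \<longleftrightarrow>
     (\<forall>X\<in>vector_fields \<A>. \<forall>Y\<in>vector_fields \<A>. D X Y \<in> vector_fields \<A>) \<and>
     (\<forall>X\<in>vector_fields \<A>. \<forall>Y\<in>vector_fields \<A>. \<forall>Z\<in>vector_fields \<A>.
        D (vf_add X Y) Z = vf_add (D X Z) (D Y Z) \<and>
        D X (vf_add Y Z) = vf_add (D X Y) (D X Z)) \<and>
     (\<forall>X\<in>vector_fields \<A>. \<forall>Y\<in>vector_fields \<A>. \<forall>f\<in>smooth_functions \<A>.
        D (vf_scale f X) Y = vf_scale f (D X Y) \<and>
        D X (vf_scale f Y) = vf_add (vf_scale f (D X Y)) (vf_scale (vf_deriv \<A> X f) Y))"

definition torsion_free ::
  "('m, 'n::finite) chart set \<Rightarrow> (('m, 'n) vfield \<Rightarrow> ('m, 'n) vfield \<Rightarrow> ('m, 'n) vfield) \<Rightarrow> bool" where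
  "torsion_free \<A> D \<longleftrightarrow>
     (\<forall>X\<in>vector_fields \<A>. \<forall>Y\<in>vector_fields \<A>.
        vf_diff (D X Y) (D Y X) = lie_bracket \<A> X Y)"

text \<open>\<open>nabla_metric \<A> g D X Y Z\<close> is the function \<open>(D\<^sub>X g)(Y, Z)\<close>.\<close>

definition nabla_metric ::
  "('m, 'n::finite) chart set \<Rightarrow> ('m \<Rightarrow> ('m, 'n) tvec \<Rightarrow> ('m, 'n) tvec \<Rightarrow> real) \<Rightarrow>
   (('m, 'n) vfield \<Rightarrow> ('m, 'n) vfield \<Rightarrow> ('m, 'n) vfield) \<Rightarrow>
   ('m, 'n) vfield \<Rightarrow> ('m, 'n) vfield \<Rightarrow> ('m, 'n) vfield \<Rightarrow> 'm \<Rightarrow> real" where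
  "nabla_metric \<A> g D X Y Z p =
     vf_deriv \<A> X (\<lambda>q. g q (Y q) (Z q)) p - g p (D X Y p) (Z p) - g p (Y p) (D X Z p)"

definition weyl_manifold ::
  "'m topology \<Rightarrow> ('m, 'n::finite) chart set \<Rightarrow>
   ('m \<Rightarrow> ('m, 'n) tvec \<Rightarrow> ('m, 'n) tvec \<Rightarrow> real) \<Rightarrow>
   (('m, 'n) vfield \<Rightarrow> ('m, 'n) vfield \<Rightarrow> ('m, 'n) vfield) \<Rightarrow> bool" where
  "weyl_manifold T \<A> g D \<longleftrightarrow>
     CARD('n) \<ge> 2 \<and> smooth_manifold T \<A> \<and> pseudo_riemannian_metric \<A> g \<and>
     connection \<A> D \<and> torsion_free \<A> D \<and>
     (\<exists>\<phi>. one_form \<A> \<phi> \<and>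
        (\<forall>X\<in>vector_fields \<A>. \<forall>Y\<in>vector_fields \<A>. \<forall>Z\<in>vector_fields \<A>. \<forall>p\<in>points \<A>.
           nabla_metric \<A> g D X Y Z p = - 2 * \<phi> p (X p) * g p (Y p) (Z p)))"

definition curvature_operator ::
  "('m, 'n::finite) chart set \<Rightarrow> (('m, 'n) vfield \<Rightarrow> ('m, 'n) vfield \<Rightarrow> ('m, 'n) vfield) \<Rightarrow>
   ('m, 'n) vfield \<Rightarrow> ('m, 'n) vfield \<Rightarrow> ('m, 'n) vfield \<Rightarrow> ('m, 'n) vfield" where
  "curvature_operator \<A> D X Y Z =
     vf_diff (vf_diff (D X (D Y Z)) (D Y (D X Z))) (D (lie_bracket \<A> X Y) Z)"

text \<open>By tensoriality the value depends only on the vectors at \<open>p\<close> and not on the vector fields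
  extending them.\<close>

definition curvature_tensor ::
  "('m, 'n::finite) chart set \<Rightarrow> ('m \<Rightarrow> ('m, 'n) tvec \<Rightarrow> ('m, 'n) tvec \<Rightarrow> real) \<Rightarrow>
   (('m, 'n) vfield \<Rightarrow> ('m, 'n) vfield \<Rightarrow> ('m, 'n) vfield) \<Rightarrow>
   'm \<Rightarrow> ('m, 'n) tvec \<Rightarrow> ('m, 'n) tvec \<Rightarrow> ('m, 'n) tvec \<Rightarrow> ('m, 'n) tvec \<Rightarrow> real" where
  "curvature_tensor \<A> g D p x y z w = (THE r.
     \<exists>X\<in>vector_fields \<A>. \<exists>Y\<in>vector_fields \<A>. \<exists>Z\<in>vector_fields \<A>.
       X p = x \<and> Y p = y \<and> Z p = z \<and> r = g p (curvature_operator \<A> D X Y Z p) w)"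

definition tangent_isomorphism ::
  "('m, 'n::finite) chart set \<Rightarrow> 'm \<Rightarrow> ('v::real_vector \<Rightarrow> ('m, 'n) tvec) \<Rightarrow> bool" where
  "tangent_isomorphism \<A> p \<Xi> \<longleftrightarrow>
     (\<forall>x y. \<Xi> (x + y) = tv_add (\<Xi> x) (\<Xi> y)) \<and> (\<forall>a x. \<Xi> (a *\<^sub>R x) = tv_scale a (\<Xi> x)) \<and>
     bij_betw \<Xi> UNIV (tangent_space \<A> p)"

end

theory Submission
  imports Defs
begin

text \<open>
  Write \<open>A = B + \<dots>\<close> with \<open>B\<close> a Riemannian algebraic curvature tensor and the rest built from \<open>h\<close>
  and the alternating form \<open>\<psi> = (Ric(y, x) - Ric(x, y)) / (2 n)\<close>. On a neighbourhood of \<open>0\<close> in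
  \<open>V\<close>, the metric \<open>g\<^sub>x(u, v) = h(u, v) - B(x, u, v, x) / 3\<close> and the form \<open>\<phi>\<^sub>x(u) = \<psi>(x, u)\<close>
  determine a torsion free Weyl connection. Since \<open>g\<close> has no linear term and \<open>\<phi>\<close> vanishes at \<open>0\<close>,
  so do the Christoffel symbols; hence the curvature at \<open>0\<close> is linear in their first derivatives,
  which are explicit in \<open>B\<close> and \<open>\<psi>\<close> and add up to \<open>A\<close>.
\<close>

section \<open>Smooth maps between normed spaces\<close>

text \<open>The constant in \<psi> is forced. A torsion free connection with \<nabla>g = -2 \<phi>
  \<otimes> g satisfies R(x, y, z, w) + R(x, y, w, z) = 2 d\<phi>(x, y) g(z, w). A form that depends
  on the point as \<psi>(x, -), with \<psi> alternating, has exterior derivative 2 \<psi>, so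
  condition (iii) at the origin asks for 4 \<psi>(x, y) = (2 / n) (Ric(y, x) - Ric(x, y)).

  The analytic obstacle is that the curvature tensor is a definite description over all smooth
  vector fields extending the given vectors. Computing with constant fields is therefore not enough:
  for arbitrary extensions the second derivatives of the fields have to cancel, which needs their
  symmetry, and the first derivatives have to be absorbed by the Lie bracket. A single chart, whose
  domain is the whole set where g is non-degenerate, turns all geometric notions into statements
  about smooth maps on an open subset of real n-space.\<close>

lemma frechet_derivative_cong_open:
  assumes "open S" "p \<in> S" "\<And>x. x \<in> S \<Longrightarrow> f x = g x"
  shows "frechet_derivative f (at p) = frechet_derivative g (at p)"
proof -
  have "(f has_derivative D) (at p) \<longleftrightarrow> (g has_derivative D) (at p)" for D
    by (auto elim!: has_derivative_transform_within_open[OF _ assms(1,2)] simp: assms(3))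
  then show ?thesis unfolding frechet_derivative_def by simp
qed

lemma Ck_on_cong:
  assumes "open S" "Ck_on k S f" "\<And>x. x \<in> S \<Longrightarrow> f x = g x"
  shows "Ck_on k S g"
  using assms(2,3)
proof (induction k arbitrary: f g)
  case 0
  then show ?case using continuous_on_cong by (metis Ck_on.simps(1))
next
  case (Suc k)
  have "g differentiable at x" if "x \<in> S" for x
  proof -
    have "(f has_derivative frechet_derivative f (at x)) (at x)"
      using Suc.prems(1) that frechet_derivative_works by auto
    then have "(g has_derivative frechet_derivative f (at x)) (at x)"
      by (rule has_derivative_transform_within_open[OF _ assms(1) that Suc.prems(2)])
    then show ?thesis by (rule differentiableI)
  qed
  moreover have "Ck_on k S (\<lambda>x. frechet_derivative g (at x) v)" for v
    by (rule Suc.IH[of "\<lambda>x. frechet_derivative f (at x) v"])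
      (use Suc.prems frechet_derivative_cong_open[OF assms(1), of _ f g] in auto)
  ultimately show ?case by simp
qed

text \<open>Since S is open, any explicit formula for the derivative on S may replace the chosen
  \<open>frechet_derivative\<close>. The inductions below use the recursion of \<open>Ck_on\<close>
  in this form.\<close>

lemma Ck_on_SucI:
  assumes "open S" "\<And>x. x \<in> S \<Longrightarrow> (f has_derivative f' x) (at x)"
    and "\<And>v. Ck_on k S (\<lambda>x. f' x v)"
  shows "Ck_on (Suc k) S f"
proof -
  have "f differentiable at x" if "x \<in> S" for x
    using assms(2)[OF that] by (rule differentiableI)
  moreover have "Ck_on k S (\<lambda>x. frechet_derivative f (at x) v)" for v
    by (rule Ck_on_cong[OF assms(1,3)]) (simp add: frechet_derivative_at[OF assms(2)])
  ultimately show ?thesis by simp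
qed

lemma Ck_on_SucD:
  assumes "Ck_on (Suc k) S f" "x \<in> S"
  shows "(f has_derivative frechet_derivative f (at x)) (at x)"
  using assms frechet_derivative_works by auto

text \<open>The product and quotient rules multiply a derivative by an undifferentiated factor. The
  order of that factor has to be lowered before an induction hypothesis applies to the
  product.\<close>

lemma Ck_on_Suc_imp: "Ck_on (Suc k) S f \<Longrightarrow> Ck_on k S f"
proof (induction k arbitrary: f)
  case 0
  then show ?case
    by (auto simp: intro!: continuous_at_imp_continuous_on differentiable_imp_continuous_within)
next
  case (Suc k)
  then show ?case by simp
qed

lemma Ck_on_const: "open S \<Longrightarrow> Ck_on k S (\<lambda>x. c)"
  by (induction k arbitrary: c) (auto intro: Ck_on_SucI)

lemma Ck_on_bounded_linear:
  assumes L: "bounded_linear L" and "open S" and "Ck_on k S f"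
  shows "Ck_on k S (\<lambda>x. L (f x))"
  using assms(3)
proof (induction k arbitrary: f)
  case 0
  then show ?case using bounded_linear.continuous_on[OF L] by auto
next
  case (Suc k)
  show ?case
    by (rule Ck_on_SucI[OF assms(2)
          bounded_linear.has_derivative[OF L Ck_on_SucD[OF Suc.prems]]])
      (use Suc in auto)
qed

lemma Ck_on_add:
  assumes "open S" "Ck_on k S f" "Ck_on k S g"
  shows "Ck_on k S (\<lambda>x. f x + g x)"
  using assms(2,3)
proof (induction k arbitrary: f g)
  case 0
  then show ?case by (auto intro: continuous_intros)
next
  case (Suc k)
  show ?case
    by (rule Ck_on_SucI[OF assms(1)
          has_derivative_add[OF Ck_on_SucD[OF Suc.prems(1)] Ck_on_SucD[OF Suc.prems(2)]]])
      (use Suc in auto)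
qed

lemma Ck_on_bounded_bilinear:
  assumes L: "bounded_bilinear mul" and "open S" and "Ck_on k S f" "Ck_on k S g"
  shows "Ck_on k S (\<lambda>x. mul (f x) (g x))"
  using assms(3,4)
proof (induction k arbitrary: f g)
  case 0
  then show ?case using bounded_bilinear.continuous_on[OF L] by auto
next
  case (Suc k)
  have "Ck_on k S f" "Ck_on k S g" using Suc.prems by (blast dest: Ck_on_Suc_imp)+
  then have "Ck_on k S (\<lambda>x. mul (f x) (frechet_derivative g (at x) v) +
      mul (frechet_derivative f (at x) v) (g x))" for v
    using Suc.prems by (intro Ck_on_add[OF assms(2)] Suc.IH) simp_all
  moreover have "((\<lambda>x. mul (f x) (g x)) has_derivative
      (\<lambda>v. mul (f x) (frechet_derivative g (at x) v) + mul (frechet_derivative f (at x) v) (g x))) (at x)"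
    if "x \<in> S" for x
    using Suc.prems that by (intro bounded_bilinear.FDERIV[OF L] Ck_on_SucD)
  ultimately show ?case by (intro Ck_on_SucI[OF assms(2)])
qed

text \<open>The derivative of 1 / f is a product of f' with two copies of 1 / f, and these are
  already known to have one order of smoothness less. Hence the induction runs with f fixed.\<close>

lemma Ck_on_inverse:
  fixes f :: "'a::real_normed_vector \<Rightarrow> real"
  assumes "open S" and "Ck_on k S f" and nz: "\<And>x. x \<in> S \<Longrightarrow> f x \<noteq> 0"
  shows "Ck_on k S (\<lambda>x. inverse (f x))"
  using assms(2)
proof (induction k)
  case 0
  then show ?case using nz by (auto intro!: continuous_intros)
next
  case (Suc k)
  have IH: "Ck_on k S (\<lambda>x. inverse (f x))"
    using Suc Ck_on_Suc_imp by blast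
  show ?case
  proof (rule Ck_on_SucI[OF assms(1)])
    show "((\<lambda>x. inverse (f x)) has_derivative
        (\<lambda>v. - (inverse (f x) * frechet_derivative f (at x) v * inverse (f x)))) (at x)"
      if "x \<in> S" for x
      by (rule Deriv.has_derivative_inverse[OF nz[OF that] Ck_on_SucD[OF Suc.prems that]])
    show "Ck_on k S (\<lambda>x. - (inverse (f x) * frechet_derivative f (at x) v * inverse (f x)))" for v
      using Suc.prems IH
      by (intro Ck_on_bounded_linear[OF bounded_linear_minus[OF bounded_linear_ident]]
          Ck_on_bounded_bilinear[OF bounded_bilinear_mult] assms(1)) auto
  qed
qed

section \<open>Closure properties of smooth maps\<close>

lemma smooth_on_cong:
  "open S \<Longrightarrow> (\<And>x. x \<in> S \<Longrightarrow> f x = g x) \<Longrightarrow> smooth_on S f \<longleftrightarrow> smooth_on S g"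
  unfolding smooth_on_def using Ck_on_cong[of S _ f g] Ck_on_cong[of S _ g f] by metis

lemma smooth_on_has_derivative:
  "smooth_on S f \<Longrightarrow> x \<in> S \<Longrightarrow> (f has_derivative frechet_derivative f (at x)) (at x)"
  unfolding smooth_on_def using Ck_on_SucD by blast

lemma smooth_on_frechet_derivative:
  "smooth_on S f \<Longrightarrow> smooth_on S (\<lambda>x. frechet_derivative f (at x) v)"
  unfolding smooth_on_def by (metis Ck_on.simps(2))

lemma smooth_on_imp_continuous_on: "smooth_on S f \<Longrightarrow> continuous_on S f"
  unfolding smooth_on_def by (metis Ck_on.simps(1))

lemma smooth_on_const: "open S \<Longrightarrow> smooth_on S (\<lambda>x. c)"
  unfolding smooth_on_def by (simp add: Ck_on_const)

lemma smooth_on_bounded_linear: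
  "bounded_linear L \<Longrightarrow> open S \<Longrightarrow> smooth_on S f \<Longrightarrow> smooth_on S (\<lambda>x. L (f x))"
  unfolding smooth_on_def by (simp add: Ck_on_bounded_linear)

lemma smooth_on_add:
  "open S \<Longrightarrow> smooth_on S f \<Longrightarrow> smooth_on S g \<Longrightarrow> smooth_on S (\<lambda>x. f x + g x)"
  unfolding smooth_on_def by (simp add: Ck_on_add)

lemma smooth_on_bounded_bilinear:
  "bounded_bilinear mul \<Longrightarrow> open S \<Longrightarrow> smooth_on S f \<Longrightarrow> smooth_on S g \<Longrightarrow>
    smooth_on S (\<lambda>x. mul (f x) (g x))"
  unfolding smooth_on_def by (simp add: Ck_on_bounded_bilinear)

lemma smooth_on_inverse:
  fixes f :: "'a::real_normed_vector \<Rightarrow> real"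
  shows "open S \<Longrightarrow> smooth_on S f \<Longrightarrow> (\<And>x. x \<in> S \<Longrightarrow> f x \<noteq> 0) \<Longrightarrow>
    smooth_on S (\<lambda>x. inverse (f x))"
  unfolding smooth_on_def by (simp add: Ck_on_inverse)

lemma smooth_on_ident: "open S \<Longrightarrow> smooth_on S (\<lambda>x. x)"
proof -
  assume S: "open S"
  have "Ck_on k S (\<lambda>x. x)" for k
  proof (cases k)
    case (Suc j)
    then show ?thesis
      using Ck_on_SucI[OF S has_derivative_ident Ck_on_const[OF S]] by simp
  qed simp
  then show ?thesis by (simp add: smooth_on_def)
qed

lemmas smooth_on_mult = smooth_on_bounded_bilinear[OF bounded_bilinear_mult]
lemmas smooth_on_scaleR = smooth_on_bounded_bilinear[OF bounded_bilinear_scaleR]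

lemma smooth_on_diff:
  assumes "open S" "smooth_on S f" "smooth_on S g"
  shows "smooth_on S (\<lambda>x. f x - g x)"
  using smooth_on_add[OF assms(1,2)
      smooth_on_bounded_linear[OF bounded_linear_minus[OF bounded_linear_ident] assms(1,3)]]
  by simp

lemma smooth_on_sum:
  assumes "open S" "\<And>i. i \<in> I \<Longrightarrow> smooth_on S (f i)"
  shows "smooth_on S (\<lambda>x. \<Sum>i\<in>I. f i x)"
  using assms(2)
  by (induction I rule: infinite_finite_induct)
    (auto intro: smooth_on_const smooth_on_add assms(1))

lemma smooth_on_prod:
  fixes f :: "'i \<Rightarrow> 'a::real_normed_vector \<Rightarrow> real"
  assumes "open S" "\<And>i. i \<in> I \<Longrightarrow> smooth_on S (f i)"
  shows "smooth_on S (\<lambda>x. \<Prod>i\<in>I. f i x)"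
  using assms(2)
  by (induction I rule: infinite_finite_induct)
    (auto intro: smooth_on_const smooth_on_mult assms(1))

lemma smooth_on_vec:
  fixes f :: "'a::real_normed_vector \<Rightarrow> real ^ 'n"
  assumes "open S" "\<And>i. smooth_on S (\<lambda>x. f x $ i)"
  shows "smooth_on S f"
proof -
  have "smooth_on S (\<lambda>x. \<Sum>i\<in>UNIV. (f x $ i) *\<^sub>R (axis i 1 :: real ^ 'n))"
    by (intro smooth_on_sum smooth_on_scaleR smooth_on_const assms)
  then show ?thesis
    by (simp only: basis_expansion[where 'a = real, unfolded scalar_mult_eq_scaleR])
qed

lemma smooth_on_det:
  fixes M :: "'a::real_normed_vector \<Rightarrow> real ^ 'n ^ 'n"
  assumes "open S" "\<And>i j. smooth_on S (\<lambda>x. M x $ i $ j)"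
  shows "smooth_on S (\<lambda>x. det (M x))"
  unfolding det_def
  by (intro smooth_on_sum smooth_on_mult smooth_on_prod smooth_on_const assms)

section \<open>Families of linear maps applied to moving vectors\<close>

lemma linear_euclidean_sum:
  fixes F :: "'a::euclidean_space \<Rightarrow> 'b::real_vector"
  assumes "linear F"
  shows "F u = (\<Sum>b\<in>Basis. (u \<bullet> b) *\<^sub>R F b)"
proof -
  have "F u = F (\<Sum>b\<in>Basis. (u \<bullet> b) *\<^sub>R b)" by (simp only: euclidean_representation)
  also have "\<dots> = (\<Sum>b\<in>Basis. (u \<bullet> b) *\<^sub>R F b)"
    by (simp only: linear_sum[OF assms] linear_scale[OF assms])
  finally show ?thesis .
qed

text \<open>\<open>Ck_on\<close> controls derivatives only in a fixed direction v, whereas a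
  covariant derivative evaluates them on a varying vector field. Expanding the moving vector in the
  standard basis reduces the second situation to the first.\<close>

lemma smooth_on_linear_apply:
  fixes Y :: "'a::real_normed_vector \<Rightarrow> 'c::euclidean_space"
  assumes S: "open S" and lin: "\<And>x. x \<in> S \<Longrightarrow> linear (F x)"
    and F: "\<And>u. smooth_on S (\<lambda>x. F x u)" and Y: "smooth_on S Y"
  shows "smooth_on S (\<lambda>x. F x (Y x))"
proof -
  have "smooth_on S (\<lambda>x. \<Sum>b\<in>Basis. (Y x \<bullet> b) *\<^sub>R F x b)"
    by (intro smooth_on_sum smooth_on_scaleR S F
        smooth_on_bounded_linear[OF bounded_linear_inner_left] Y)
  then show ?thesis
    by (rule smooth_on_cong[OF S, THEN iffD1, rotated])
      (simp only: linear_euclidean_sum[OF lin, symmetric])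
qed

lemma has_derivative_linear_apply:
  fixes Y :: "'a::real_normed_vector \<Rightarrow> 'c::euclidean_space"
  assumes S: "open S" "p \<in> S" and lin: "\<And>x. x \<in> S \<Longrightarrow> linear (F x)"
    and F: "\<And>u. ((\<lambda>x. F x u) has_derivative (\<lambda>v. F' v u)) (at p)"
    and Y: "(Y has_derivative Y') (at p)"
  shows "((\<lambda>x. F x (Y x)) has_derivative (\<lambda>v. F p (Y' v) + F' v (Y p))) (at p)"
proof -
  \<comment> \<open>Linearity of F' in its second argument is not assumed: it is inherited from F,
    because the derivative at an interior point is unique.\<close>
  have "linear (F' v)" for v
  proof (rule linearI)
    fix a :: real and u w
    have "((\<lambda>x. F x u + F x w) has_derivative (\<lambda>v. F' v (u + w))) (at p)"
      by (rule has_derivative_transform_within_open[OF F S]) (simp add: linear_add[OF lin])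
    from has_derivative_unique[OF this has_derivative_add[OF F F]]
    show "F' v (u + w) = F' v u + F' v w" by meson
    have "((\<lambda>x. a *\<^sub>R F x u) has_derivative (\<lambda>v. F' v (a *\<^sub>R u))) (at p)"
      by (rule has_derivative_transform_within_open[OF F S]) (simp add: linear_scale[OF lin])
    from has_derivative_unique[OF this has_derivative_scaleR_right[OF F]]
    show "F' v (a *\<^sub>R u) = a *\<^sub>R F' v u" by meson
  qed
  note F'_sum = linear_euclidean_sum[OF this]
  have "((\<lambda>x. \<Sum>b\<in>Basis. (Y x \<bullet> b) *\<^sub>R F x b) has_derivative
      (\<lambda>v. \<Sum>b\<in>Basis. (Y p \<bullet> b) *\<^sub>R F' v b + (Y' v \<bullet> b) *\<^sub>R F p b)) (at p)"
    by (intro has_derivative_sum has_derivative_scaleR F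
        bounded_linear.has_derivative[OF bounded_linear_inner_left] Y)
  moreover have "(\<Sum>b\<in>Basis. (Y p \<bullet> b) *\<^sub>R F' v b + (Y' v \<bullet> b) *\<^sub>R F p b) = F p (Y' v) + F' v (Y p)"
    for v
    unfolding sum.distrib F'_sum[symmetric] linear_euclidean_sum[OF lin[OF S(2)], symmetric]
    by (rule add.commute)
  ultimately have "((\<lambda>x. \<Sum>b\<in>Basis. (Y x \<bullet> b) *\<^sub>R F x b) has_derivative
      (\<lambda>v. F p (Y' v) + F' v (Y p))) (at p)" by simp
  then show ?thesis
    by (rule has_derivative_transform_within_open[OF _ S])
      (simp add: linear_euclidean_sum[OF lin, symmetric])
qed

text \<open>The second difference is symmetric in \<open>v\<close> and \<open>w\<close>, which yields the symmetry of the second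
  derivative in the limit \<open>t \<rightarrow> 0\<close>.\<close>

lemma second_difference_mean_value:
  fixes f :: "'a::real_normed_vector \<Rightarrow> real"
  assumes S: "\<And>a b. 0 \<le> a \<Longrightarrow> a \<le> t \<Longrightarrow> 0 \<le> b \<Longrightarrow> b \<le> t \<Longrightarrow> p + a *\<^sub>R v + b *\<^sub>R w \<in> S"
    and f: "\<And>x. x \<in> S \<Longrightarrow> (f has_derivative f' x) (at x)"
    and f': "\<And>x. x \<in> S \<Longrightarrow> ((\<lambda>x. f' x v) has_derivative f'' x) (at x)"
    and "0 < t"
  shows "\<exists>a b. 0 < a \<and> a < t \<and> 0 < b \<and> b < t \<and>
    f (p + t *\<^sub>R v + t *\<^sub>R w) - f (p + t *\<^sub>R v) - f (p + t *\<^sub>R w) + f p =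
    t * (t * f'' (p + a *\<^sub>R v + b *\<^sub>R w) w)"
proof -
  have "((\<lambda>a. f (p + a *\<^sub>R v + b *\<^sub>R w)) has_derivative
      (\<lambda>r. f' (p + a *\<^sub>R v + b *\<^sub>R w) (r *\<^sub>R v))) (at a)"
    if "0 \<le> a" "a \<le> t" "0 \<le> b" "b \<le> t" for a b
  proof -
    have "((\<lambda>a. p + a *\<^sub>R v + b *\<^sub>R w) has_derivative (\<lambda>r. r *\<^sub>R v)) (at a)"
      by (auto intro!: derivative_eq_intros)
    from has_derivative_compose[OF this f[OF S[OF that]]] show ?thesis .
  qed
  moreover have "f' x (r *\<^sub>R v) = r * f' x v" if "x \<in> S" for x r
    using linear_scale[OF has_derivative_linear[OF f[OF that]]] by simp
  ultimately have D1: "((\<lambda>a. f (p + a *\<^sub>R v + b *\<^sub>R w)) has_real_derivative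
      f' (p + a *\<^sub>R v + b *\<^sub>R w) v) (at a)"
    if "0 \<le> a" "a \<le> t" "0 \<le> b" "b \<le> t" for a b
    using that S unfolding has_field_derivative_def by (simp add: mult_commute_abs)
  have "((\<lambda>b. f' (p + a *\<^sub>R v + b *\<^sub>R w) v) has_derivative
      (\<lambda>r. f'' (p + a *\<^sub>R v + b *\<^sub>R w) (r *\<^sub>R w))) (at b)"
    if "0 \<le> a" "a \<le> t" "0 \<le> b" "b \<le> t" for a b
  proof -
    have "((\<lambda>b. p + a *\<^sub>R v + b *\<^sub>R w) has_derivative (\<lambda>r. r *\<^sub>R w)) (at b)"
      by (auto intro!: derivative_eq_intros)
    from has_derivative_compose[OF this f'[OF S[OF that]]] show ?thesis .
  qed
  moreover have "f'' x (r *\<^sub>R w) = r * f'' x w" if "x \<in> S" for x r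
    using linear_scale[OF has_derivative_linear[OF f'[OF that]]] by simp
  ultimately have D2: "((\<lambda>b. f' (p + a *\<^sub>R v + b *\<^sub>R w) v) has_real_derivative
      f'' (p + a *\<^sub>R v + b *\<^sub>R w) w) (at b)"
    if "0 \<le> a" "a \<le> t" "0 \<le> b" "b \<le> t" for a b
    using that S unfolding has_field_derivative_def by (simp add: mult_commute_abs)
  have "\<exists>a>0. a < t \<and>
    (f (p + t *\<^sub>R v + t *\<^sub>R w) - f (p + t *\<^sub>R v + 0 *\<^sub>R w)) - (f (p + 0 *\<^sub>R v + t *\<^sub>R w) - f (p + 0 *\<^sub>R v + 0 *\<^sub>R w)) =
    (t - 0) * (f' (p + a *\<^sub>R v + t *\<^sub>R w) v - f' (p + a *\<^sub>R v + 0 *\<^sub>R w) v)"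
    by (rule MVT2[OF \<open>0 < t\<close>]) (use \<open>0 < t\<close> in \<open>intro DERIV_diff D1, auto\<close>)
  then obtain a where a: "0 < a" "a < t" 
    "f (p + t *\<^sub>R v + t *\<^sub>R w) - f (p + t *\<^sub>R v) - f (p + t *\<^sub>R w) + f p =
    t * (f' (p + a *\<^sub>R v + t *\<^sub>R w) v - f' (p + a *\<^sub>R v + 0 *\<^sub>R w) v)"
    by auto
  have "\<exists>b>0. b < t \<and> f' (p + a *\<^sub>R v + t *\<^sub>R w) v - f' (p + a *\<^sub>R v + 0 *\<^sub>R w) v =
    (t - 0) * f'' (p + a *\<^sub>R v + b *\<^sub>R w) w"
    by (rule MVT2[OF \<open>0 < t\<close>]) (use a in \<open>intro D2, auto\<close>)
  with a show ?thesis by auto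
qed

lemma second_derivative_symmetric_real:
  fixes f :: "'a::real_normed_vector \<Rightarrow> real"
  assumes S: "open S" "p \<in> S" and f: "smooth_on S f"
  shows "frechet_derivative (\<lambda>x. frechet_derivative f (at x) v) (at p) w =
    frechet_derivative (\<lambda>x. frechet_derivative f (at x) w) (at p) v"
proof -
  define H where "H v w x = frechet_derivative (\<lambda>x. frechet_derivative f (at x) v) (at x) w" for v w x
  define \<Delta> where "\<Delta> t = f (p + t *\<^sub>R v + t *\<^sub>R w) - f (p + t *\<^sub>R v) - f (p + t *\<^sub>R w) + f p" for t
  have "\<bar>H v w p - H w v p\<bar> \<le> e" if "e > 0" for e
  proof -
    have cont: "isCont (H v w) p" for v w
      using smooth_on_imp_continuous_on[OF smooth_on_frechet_derivative[OF
            smooth_on_frechet_derivative[OF f]]] S continuous_on_eq_continuous_at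
      unfolding H_def by blast
    have "eventually (\<lambda>x. x \<in> S \<and> dist (H v w x) (H v w p) < e / 2 \<and>
        dist (H w v x) (H w v p) < e / 2) (at p)"
      using cont[unfolded isCont_def, THEN tendstoD, of "e / 2"] \<open>e > 0\<close>
        eventually_at_in_open'[OF S]
      by (auto intro!: eventually_conj)
    then obtain d where d: "d > 0" and d_near: "\<And>x. x \<noteq> p \<Longrightarrow> dist x p < d \<Longrightarrow>
        x \<in> S \<and> dist (H v w x) (H v w p) < e / 2 \<and> dist (H w v x) (H w v p) < e / 2"
      unfolding eventually_at by blast
    have near: "x \<in> S \<and> dist (H v w x) (H v w p) < e / 2 \<and> dist (H w v x) (H w v p) < e / 2"
      if "dist x p < d" for x
      using d_near[OF _ that] S(2) \<open>e > 0\<close> by (cases "x = p") auto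
    \<comment> \<open>With this t the whole parallelogram spanned by t v and t w at p lies in the
      ball of radius d. The summand 1 keeps the denominator positive when v = w = 0.\<close>
    define t where "t = d / (norm v + norm w + 1)"
    have t: "0 < t" using d by (simp add: t_def add_nonneg_pos)
    have close: "dist (p + a *\<^sub>R v + b *\<^sub>R w) p < d" if "0 \<le> a" "a \<le> t" "0 \<le> b" "b \<le> t" for a b
    proof -
      have "norm (a *\<^sub>R v + b *\<^sub>R w) \<le> t * norm v + t * norm w"
        using that by (intro norm_triangle_mono) (auto intro: mult_right_mono)
      also have "\<dots> < t * (norm v + norm w + 1)"
        using t by (simp add: algebra_simps)
      also have "\<dots> = d" using d by (simp add: t_def add_nonneg_pos add_nonneg_eq_0_iff)
      finally show ?thesis by (simp add: dist_norm add.assoc)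
    qed
    have close': "dist (p + a *\<^sub>R w + b *\<^sub>R v) p < d" if "0 \<le> a" "a \<le> t" "0 \<le> b" "b \<le> t" for a b
      using close[of b a] that by (simp add: ac_simps)
    obtain a b where ab: "0 < a" "a < t" "0 < b" "b < t"
      "\<Delta> t = t * (t * H v w (p + a *\<^sub>R v + b *\<^sub>R w))"
      using second_difference_mean_value[of t p v w S f, OF _ smooth_on_has_derivative[OF f]
        smooth_on_has_derivative[OF smooth_on_frechet_derivative[OF f]] t] near[OF close]
      unfolding H_def \<Delta>_def by metis
    obtain a' b' where ab': "0 < a'" "a' < t" "0 < b'" "b' < t"
      "f (p + t *\<^sub>R w + t *\<^sub>R v) - f (p + t *\<^sub>R w) - f (p + t *\<^sub>R v) + f p =
       t * (t * H w v (p + a' *\<^sub>R w + b' *\<^sub>R v))"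
      using second_difference_mean_value[of t p w v S f, OF _ smooth_on_has_derivative[OF f]
        smooth_on_has_derivative[OF smooth_on_frechet_derivative[OF f]] t] near[OF close']
      unfolding H_def by metis
    have "\<Delta> t = f (p + t *\<^sub>R w + t *\<^sub>R v) - f (p + t *\<^sub>R w) - f (p + t *\<^sub>R v) + f p"
      by (simp add: \<Delta>_def ac_simps)
    \<comment> \<open>Both mixed derivatives equal the same second difference divided by t * t, at
      two possibly different points near p.\<close>
    with ab ab' t have "H v w (p + a *\<^sub>R v + b *\<^sub>R w) = H w v (p + a' *\<^sub>R w + b' *\<^sub>R v)"
      by simp
    moreover have "dist (H v w (p + a *\<^sub>R v + b *\<^sub>R w)) (H v w p) < e / 2"
      using near[OF close] ab by simp
    moreover have "dist (H w v (p + a' *\<^sub>R w + b' *\<^sub>R v)) (H w v p) < e / 2"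
      using near[OF close'] ab' by simp
    ultimately show ?thesis unfolding dist_real_def by linarith
  qed
  then have "\<bar>H v w p - H w v p\<bar> \<le> 0" by (rule field_le_epsilon) simp
  then show ?thesis by (simp add: H_def)
qed

lemma second_derivative_symmetric:
  fixes f :: "'a::real_normed_vector \<Rightarrow> 'b::euclidean_space"
  assumes S: "open S" "p \<in> S" and f: "smooth_on S f"
  shows "frechet_derivative (\<lambda>x. frechet_derivative f (at x) v) (at p) w =
    frechet_derivative (\<lambda>x. frechet_derivative f (at x) w) (at p) v"
proof (rule euclidean_eqI)
  fix b :: 'b
  have D: "frechet_derivative (\<lambda>x. g x \<bullet> b) (at x) v = frechet_derivative g (at x) v \<bullet> b"
    if "smooth_on S g" "x \<in> S" for x v and g :: "'a \<Rightarrow> 'b"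
    using frechet_derivative_at[OF bounded_linear.has_derivative[OF bounded_linear_inner_left
          smooth_on_has_derivative[OF that]]] by metis
  have "frechet_derivative (\<lambda>x. frechet_derivative (\<lambda>x. f x \<bullet> b) (at x) v) (at p) w =
    frechet_derivative (\<lambda>x. frechet_derivative f (at x) v) (at p) w \<bullet> b" for v w
    using frechet_derivative_cong_open[OF S, of "\<lambda>x. frechet_derivative (\<lambda>x. f x \<bullet> b) (at x) v"
        "\<lambda>x. frechet_derivative f (at x) v \<bullet> b"] D[OF f]
      D[OF smooth_on_frechet_derivative[OF f] S(2)] by simp
  then show "frechet_derivative (\<lambda>x. frechet_derivative f (at x) v) (at p) w \<bullet> b =
    frechet_derivative (\<lambda>x. frechet_derivative f (at x) w) (at p) v \<bullet> b"
    using second_derivative_symmetric_real[OF S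
        smooth_on_bounded_linear[OF bounded_linear_inner_left S(1) f]] by metis
qed

section \<open>Manifolds with a single chart\<close>

locale coordinate_domain =
  fixes U :: "(real ^ 'n::finite) set"
  assumes open_U: "open U"
begin

definition coord :: "(real ^ 'n, 'n) chart" where
  "coord = (U, \<lambda>x. x)"

definition atlas :: "(real ^ 'n, 'n) chart set" where
  "atlas = {coord}"

text \<open>A tangent vector is a family over all charts, so a coordinate vector is placed at
  \<open>coord\<close> and extended by zero. For p outside U the result is the zero family, as the
  tangent space there requires; a field is thus determined by its coordinates on U.\<close>

definition tv :: "real ^ 'n \<Rightarrow> real ^ 'n \<Rightarrow> (real ^ 'n, 'n) tvec" where
  "tv p u = (\<lambda>d. if d \<in> charts_at atlas p then u else 0)"

definition vf :: "(real ^ 'n \<Rightarrow> real ^ 'n) \<Rightarrow> (real ^ 'n, 'n) vfield" where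
  "vf \<xi> = (\<lambda>p. tv p (\<xi> p))"

lemma coord_simps [simp]: "fst coord = U" "snd coord = (\<lambda>x. x)"
  by (simp_all add: coord_def)

lemma chart_inv_coord [simp]: "x \<in> U \<Longrightarrow> chart_inv coord x = x"
  unfolding chart_inv_def using inv_into_f_f[of "\<lambda>x. x" U x] by simp

lemma charts_at_atlas [simp]: "d \<in> charts_at atlas p \<longleftrightarrow> d = coord \<and> p \<in> U"
  by (auto simp: charts_at_def atlas_def)

lemma ball_atlas [simp]: "(\<forall>d\<in>atlas. P d) \<longleftrightarrow> P coord"
  by (simp add: atlas_def)

lemma points_atlas [simp]: "points atlas = U"
  by (simp add: points_def atlas_def)

lemma tv_coord [simp]: "p \<in> U \<Longrightarrow> tv p u coord = u"
  by (simp add: tv_def)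

lemma tv_add_tv: "tv_add (tv p u) (tv p v) = tv p (u + v)"
  and tv_diff_tv: "tv_diff (tv p u) (tv p v) = tv p (u - v)"
  and tv_scale_tv: "tv_scale a (tv p u) = tv p (a *\<^sub>R u)"
  by (auto simp: tv_add_def tv_diff_def tv_scale_def tv_def)

lemma frechet_chart_inv:
  assumes "p \<in> U"
  shows "frechet_derivative (\<lambda>x. f (chart_inv coord x)) (at p) = frechet_derivative f (at p)"
  by (rule frechet_derivative_cong_open[OF open_U assms]) simp

text \<open>The only transition map is the identity near p, with derivative the identity. The
  compatibility condition is then void, and only vanishing off the charts around p remains.\<close>

lemma tangent_space_iff: "v \<in> tangent_space atlas p \<longleftrightarrow> v = tv p (v coord)"
proof -
  have "frechet_derivative ((\<lambda>x. x) \<circ> chart_inv coord) (at p) u = u" if "p \<in> U" for u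
    using frechet_chart_inv[OF that, of "\<lambda>x. x"] by (simp add: o_def)
  then have "v \<in> tangent_space atlas p \<longleftrightarrow> (\<forall>d. d \<notin> charts_at atlas p \<longrightarrow> v d = 0)"
    by (auto simp: tangent_space_def)
  also have "\<dots> \<longleftrightarrow> v = tv p (v coord)"
    by (auto simp: tv_def fun_eq_iff)
  finally show ?thesis .
qed

lemma tv_in_tangent_space: "tv p u \<in> tangent_space atlas p"
  by (simp add: tangent_space_iff tv_def)

lemma tangent_spaceE:
  assumes "v \<in> tangent_space atlas p"
  obtains u where "v = tv p u"
  using assms that[of "v coord"] unfolding tangent_space_iff by simp

lemma vf_apply: "vf \<xi> p = tv p (\<xi> p)"
  by (simp add: vf_def)

lemma vf_coord: "p \<in> U \<Longrightarrow> vf \<xi> p coord = \<xi> p"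
  by (simp add: vf_apply)

lemma vf_eq_0: "d \<notin> charts_at atlas p \<Longrightarrow> vf \<xi> p d = 0"
  by (auto simp: vf_apply tv_def)

lemma vf_cong: "(\<And>p. p \<in> U \<Longrightarrow> \<xi> p = \<eta> p) \<Longrightarrow> vf \<xi> = vf \<eta>"
  by (auto simp: vf_def tv_def fun_eq_iff)

lemma smooth_chart_inv: "smooth_on U (\<lambda>x. f (chart_inv coord x)) \<longleftrightarrow> smooth_on U f"
  by (rule smooth_on_cong[OF open_U]) simp

lemma smooth_functions_iff: "f \<in> smooth_functions atlas \<longleftrightarrow> smooth_on U f"
  by (simp add: smooth_functions_def atlas_def o_def smooth_chart_inv)

lemma vf_in_vector_fields: "vf \<xi> \<in> vector_fields atlas \<longleftrightarrow> smooth_on U \<xi>"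
proof -
  have "smooth_on U (\<lambda>x. vf \<xi> (chart_inv coord x) coord) \<longleftrightarrow> smooth_on U \<xi>"
    by (rule smooth_on_cong[OF open_U]) (simp add: vf_apply)
  then show ?thesis
    by (simp add: vector_fields_def vf_apply tv_in_tangent_space)
qed

lemma vector_fieldsE:
  assumes "X \<in> vector_fields atlas"
  obtains \<xi> where "X = vf \<xi>" "smooth_on U \<xi>"
proof
  show "X = vf (\<lambda>p. X p coord)"
    using assms by (intro ext) (simp add: vf_def vector_fields_def tangent_space_iff)
  with assms show "smooth_on U (\<lambda>p. X p coord)"
    using vf_in_vector_fields[of "\<lambda>p. X p coord"] by simp
qed

lemma vf_add_vf: "vf_add (vf \<xi>) (vf \<eta>) = vf (\<lambda>p. \<xi> p + \<eta> p)"
  and vf_diff_vf: "vf_diff (vf \<xi>) (vf \<eta>) = vf (\<lambda>p. \<xi> p - \<eta> p)"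
  and vf_scale_vf: "vf_scale f (vf \<xi>) = vf (\<lambda>p. f p *\<^sub>R \<xi> p)"
  by (simp_all add: vf_add_def vf_diff_def vf_scale_def vf_def tv_add_tv tv_diff_tv tv_scale_tv)

lemma vf_deriv_vf: "p \<in> U \<Longrightarrow> vf_deriv atlas (vf \<xi>) f p = frechet_derivative f (at p) (\<xi> p)"
  by (simp add: vf_deriv_def vf_apply o_def frechet_chart_inv)

lemma frechet_vf:
  assumes "p \<in> U"
  shows "frechet_derivative (\<lambda>x. vf \<xi> x coord) (at p) = frechet_derivative \<xi> (at p)"
  by (rule frechet_derivative_cong_open[OF open_U assms]) (simp add: vf_apply)

lemma lie_bracket_vf: "lie_bracket atlas (vf \<xi>) (vf \<eta>) =
    vf (\<lambda>p. frechet_derivative \<eta> (at p) (\<xi> p) - frechet_derivative \<xi> (at p) (\<eta> p))"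
proof -
  have "frechet_derivative (\<lambda>x. vf \<zeta> (chart_inv coord x) coord) (at p) = frechet_derivative \<zeta> (at p)"
    if "p \<in> U" for \<zeta> p
    by (rule frechet_derivative_cong_open[OF open_U that]) (simp add: vf_apply)
  then show ?thesis
    by (auto simp: lie_bracket_def fun_eq_iff vf_coord vf_eq_0)
qed

lemma smooth_manifold_atlas: "smooth_manifold (top_of_set U) atlas"
proof -
  have "homeomorphic_map (top_of_set U) (top_of_set U) (\<lambda>x. x)"
    using homeomorphic_map_id[of "top_of_set U" "top_of_set U"] unfolding id_def by simp
  moreover have "smooth_on U ((\<lambda>x. x) \<circ> chart_inv coord)"
    using smooth_chart_inv[of "\<lambda>x. x"] smooth_on_ident[OF open_U] by (simp add: o_def)
  moreover have "second_countable (top_of_set U)"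
  proof (rule second_countable_subtopology)
    obtain B :: "(real ^ 'n) set set" where B: "countable B" "topological_basis B"
      using ex_countable_basis by blast
    have "\<exists>V\<in>B. x \<in> V \<and> V \<subseteq> W" if "open W" "x \<in> W" for W x
      using topological_basisE[OF B(2) that] by metis
    then show "second_countable (euclidean :: (real ^ 'n) topology)"
      unfolding second_countable_def using B topological_basis_open[OF B(2)]
      by (intro exI[of _ B]) auto
  qed
  moreover have "Hausdorff_space (top_of_set U)"
    by (intro Hausdorff_space_subtopology metrizable_imp_Hausdorff_space metrizable_space_euclidean)
  ultimately show ?thesis
    by (simp add: smooth_manifold_def atlas_def points_def open_U subtopology_subtopology)
qed

lemma tangent_isomorphism_tv:
  assumes "p \<in> U" and L: "linear L" "bij L"
  shows "tangent_isomorphism atlas p (\<lambda>x. tv p (L x))"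
proof -
  have "inj (\<lambda>x. tv p (L x))"
    using bij_is_inj[OF L(2)] by (intro injI) (metis tv_coord[OF assms(1)] injD)
  moreover have "tangent_space atlas p \<subseteq> range (\<lambda>x. tv p (L x))"
  proof
    fix v assume "v \<in> tangent_space atlas p"
    then obtain u where "v = tv p u" by (rule tangent_spaceE)
    moreover obtain x where "u = L x" using bij_is_surj[OF L(2)] by (rule surjE)
    ultimately show "v \<in> range (\<lambda>x. tv p (L x))" by simp
  qed
  ultimately show ?thesis
    by (auto simp: tangent_isomorphism_def bij_betw_def tv_in_tangent_space tv_add_tv tv_scale_tv
        linear_add[OF L(1)] linear_scale[OF L(1)])
qed

end

section \<open>Connections with prescribed Christoffel symbols\<close>

locale coordinate_connection = coordinate_domain U for U :: "(real ^ 'n::finite) set" +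
  fixes \<Gamma> :: "real ^ 'n \<Rightarrow> real ^ 'n \<Rightarrow> real ^ 'n \<Rightarrow> real ^ 'n"
  assumes bilinear_\<Gamma>: "p \<in> U \<Longrightarrow> bilinear (\<Gamma> p)"
    and \<Gamma>_commute: "p \<in> U \<Longrightarrow> \<Gamma> p u v = \<Gamma> p v u"
    and smooth_\<Gamma>: "smooth_on U \<xi> \<Longrightarrow> smooth_on U \<eta> \<Longrightarrow> smooth_on U (\<lambda>x. \<Gamma> x (\<xi> x) (\<eta> x))"
begin

definition D :: "(real ^ 'n, 'n) vfield \<Rightarrow> (real ^ 'n, 'n) vfield \<Rightarrow> (real ^ 'n, 'n) vfield" where
  "D X Y = vf (\<lambda>p. frechet_derivative (\<lambda>x. Y x coord) (at p) (X p coord) +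
     \<Gamma> p (X p coord) (Y p coord))"

lemma D_vf: "D (vf \<xi>) (vf \<eta>) =
    vf (\<lambda>p. frechet_derivative \<eta> (at p) (\<xi> p) + \<Gamma> p (\<xi> p) (\<eta> p))"
  unfolding D_def by (rule vf_cong) (simp add: frechet_vf vf_coord)

text \<open>This separates the derivative of \<eta> from the second derivative of \<zeta>. In the
  curvature the former is cancelled by the bracket and the latter by symmetry.\<close>

lemma has_derivative_frechet_apply:
  assumes "smooth_on U \<zeta>" "smooth_on U \<eta>" "p \<in> U"
  shows "((\<lambda>x. frechet_derivative \<zeta> (at x) (\<eta> x)) has_derivative
    (\<lambda>v. frechet_derivative \<zeta> (at p) (frechet_derivative \<eta> (at p) v) +
      frechet_derivative (\<lambda>x. frechet_derivative \<zeta> (at x) (\<eta> p)) (at p) v)) (at p)"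
proof (rule has_derivative_linear_apply[OF open_U assms(3)])
  show "linear (frechet_derivative \<zeta> (at x))" if "x \<in> U" for x
    by (rule has_derivative_linear[OF smooth_on_has_derivative[OF assms(1) that]])
  show "((\<lambda>x. frechet_derivative \<zeta> (at x) u) has_derivative
      frechet_derivative (\<lambda>x. frechet_derivative \<zeta> (at x) u) (at p)) (at p)" for u
    by (rule smooth_on_has_derivative[OF smooth_on_frechet_derivative[OF assms(1)] assms(3)])
  show "(\<eta> has_derivative frechet_derivative \<eta> (at p)) (at p)"
    by (rule smooth_on_has_derivative[OF assms(2,3)])
qed

lemma smooth_covariant_derivative:
  assumes "smooth_on U \<xi>" "smooth_on U \<eta>"
  shows "smooth_on U (\<lambda>p. frechet_derivative \<eta> (at p) (\<xi> p) + \<Gamma> p (\<xi> p) (\<eta> p))"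
proof (intro smooth_on_add open_U smooth_\<Gamma> assms)
  show "smooth_on U (\<lambda>p. frechet_derivative \<eta> (at p) (\<xi> p))"
  proof (rule smooth_on_linear_apply[OF open_U _ _ assms(1)])
    show "linear (frechet_derivative \<eta> (at x))" if "x \<in> U" for x
      by (rule has_derivative_linear[OF smooth_on_has_derivative[OF assms(2) that]])
  qed (rule smooth_on_frechet_derivative[OF assms(2)])
qed

lemma torsion_free_D: "torsion_free atlas D"
  by (auto simp: torsion_free_def D_vf vf_diff_vf lie_bracket_vf \<Gamma>_commute
      elim!: vector_fieldsE intro!: vf_cong)

lemma connection_D: "connection atlas D"
  unfolding connection_def
proof (intro conjI ballI; (elim vector_fieldsE)?)
  fix X Y \<xi> \<eta> assume X: "X = vf \<xi>" "smooth_on U \<xi>" and Y: "Y = vf \<eta>" "smooth_on U \<eta>"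
  show "D X Y \<in> vector_fields atlas"
    using X Y by (simp add: D_vf vf_in_vector_fields smooth_covariant_derivative)
  have lin: "linear (frechet_derivative \<eta> (at p))" if "p \<in> U" for p
    using has_derivative_linear[OF smooth_on_has_derivative[OF Y(2) that]] .
  {
    fix Z \<zeta> assume Z: "Z = vf \<zeta>" "smooth_on U \<zeta>"
    have lin_\<zeta>: "linear (frechet_derivative \<zeta> (at p))" if "p \<in> U" for p
      using has_derivative_linear[OF smooth_on_has_derivative[OF Z(2) that]] .
    show "D (vf_add X Y) Z = vf_add (D X Z) (D Y Z)"
      unfolding X Y Z vf_add_vf D_vf
      by (rule vf_cong) (simp add: linear_add[OF lin_\<zeta>] bilinear_ladd[OF bilinear_\<Gamma>])
    show "D X (vf_add Y Z) = vf_add (D X Y) (D X Z)"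
      unfolding X Y Z vf_add_vf D_vf
      by (rule vf_cong) (simp add: bilinear_radd[OF bilinear_\<Gamma>]
          flip: frechet_derivative_at[OF has_derivative_add[OF
              smooth_on_has_derivative[OF Y(2)] smooth_on_has_derivative[OF Z(2)]]])
  }
  fix f assume "f \<in> smooth_functions atlas"
  then have f: "smooth_on U f" by (simp add: smooth_functions_iff)
  show "D (vf_scale f X) Y = vf_scale f (D X Y)"
    unfolding X Y vf_scale_vf D_vf
    by (rule vf_cong) (simp add: linear_scale[OF lin] bilinear_lmul[OF bilinear_\<Gamma>] scaleR_add_right)
  show "D X (vf_scale f Y) = vf_add (vf_scale f (D X Y)) (vf_scale (vf_deriv atlas X f) Y)"
    unfolding X Y vf_scale_vf D_vf vf_add_vf
    by (rule vf_cong) (simp add: bilinear_rmul[OF bilinear_\<Gamma>] vf_deriv_vf scaleR_add_right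
        flip: frechet_derivative_at[OF has_derivative_scaleR[OF
            smooth_on_has_derivative[OF f] smooth_on_has_derivative[OF Y(2)]]])
qed

text \<open>Where \<Gamma> vanishes, the terms quadratic in \<Gamma> drop out. The second
  derivatives of \<zeta> cancel by symmetry, and the terms with first derivatives of \<xi> and
  \<eta> are removed by the covariant derivative along [X, Y]. What is left are derivatives of
  \<Gamma> along the fields.\<close>

lemma curvature_operator_vf:
  assumes "smooth_on U \<xi>" "smooth_on U \<eta>" "smooth_on U \<zeta>" "p \<in> U"
    and zero: "\<And>u v. \<Gamma> p u v = 0"
  shows "curvature_operator atlas D (vf \<xi>) (vf \<eta>) (vf \<zeta>) p =
    tv p (frechet_derivative (\<lambda>x. \<Gamma> x (\<eta> x) (\<zeta> x)) (at p) (\<xi> p) -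
      frechet_derivative (\<lambda>x. \<Gamma> x (\<xi> x) (\<zeta> x)) (at p) (\<eta> p))"
proof -
  have second: "frechet_derivative
      (\<lambda>x. frechet_derivative \<zeta> (at x) (\<eta> x) + \<Gamma> x (\<eta> x) (\<zeta> x)) (at p) v =
    frechet_derivative \<zeta> (at p) (frechet_derivative \<eta> (at p) v) +
    frechet_derivative (\<lambda>x. frechet_derivative \<zeta> (at x) (\<eta> p)) (at p) v +
    frechet_derivative (\<lambda>x. \<Gamma> x (\<eta> x) (\<zeta> x)) (at p) v"
    if "smooth_on U \<eta>" for v \<eta>
    by (rule frechet_derivative_at[OF has_derivative_add[OF
          has_derivative_frechet_apply[OF assms(3) that assms(4)]
          smooth_on_has_derivative[OF smooth_\<Gamma>[OF that assms(3)] assms(4)]],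
          symmetric, THEN fun_cong])
  have sym: "frechet_derivative (\<lambda>x. frechet_derivative \<zeta> (at x) (\<eta> p)) (at p) (\<xi> p) =
      frechet_derivative (\<lambda>x. frechet_derivative \<zeta> (at x) (\<xi> p)) (at p) (\<eta> p)"
    by (rule second_derivative_symmetric[OF open_U assms(4,3)])
  have "linear (frechet_derivative \<zeta> (at p))"
    by (rule has_derivative_linear[OF smooth_on_has_derivative[OF assms(3,4)]])
  then show ?thesis
    by (simp add: curvature_operator_def D_vf vf_diff_vf lie_bracket_vf vf_apply zero
        second[OF assms(1)] second[OF assms(2)] sym linear_diff)
qed

text \<open>The definite description needs a value common to all extensions, which is why
  \<open>eq\<close> ranges over arbitrary smooth maps with the given values at p, and at least one
  extension.\<close>

lemma curvature_tensor_eqI: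
  assumes "p \<in> U" and zero: "\<And>u v. \<Gamma> p u v = 0"
    and eq: "\<And>\<xi> \<eta> \<zeta>. smooth_on U \<xi> \<Longrightarrow> smooth_on U \<eta> \<Longrightarrow> smooth_on U \<zeta> \<Longrightarrow>
      \<xi> p = x \<Longrightarrow> \<eta> p = y \<Longrightarrow> \<zeta> p = z \<Longrightarrow>
      g p (tv p (frechet_derivative (\<lambda>x. \<Gamma> x (\<eta> x) (\<zeta> x)) (at p) x -
        frechet_derivative (\<lambda>x. \<Gamma> x (\<xi> x) (\<zeta> x)) (at p) y)) w = r"
  shows "curvature_tensor atlas g D p (tv p x) (tv p y) (tv p z) w = r"
  unfolding curvature_tensor_def
proof (rule the_equality)
  have "g p (curvature_operator atlas D (vf \<xi>) (vf \<eta>) (vf \<zeta>) p) w = r"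
    if "smooth_on U \<xi>" "smooth_on U \<eta>" "smooth_on U \<zeta>" "vf \<xi> p = tv p x" "vf \<eta> p = tv p y"
      "vf \<zeta> p = tv p z" for \<xi> \<eta> \<zeta>
  proof -
    have "\<xi> p = x" "\<eta> p = y" "\<zeta> p = z"
      using that(4-6) vf_coord[OF \<open>p \<in> U\<close>] tv_coord[OF \<open>p \<in> U\<close>] by metis+
    then show ?thesis
      using curvature_operator_vf[OF that(1-3) \<open>p \<in> U\<close> zero] eq[OF that(1-3)] by simp
  qed
  note * = this
  show "r' = r" if "\<exists>X\<in>vector_fields atlas. \<exists>Y\<in>vector_fields atlas. \<exists>Z\<in>vector_fields atlas.
       X p = tv p x \<and> Y p = tv p y \<and> Z p = tv p z \<and> r' = g p (curvature_operator atlas D X Y Z p) w" for r'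
    using that by (elim bexE conjE vector_fieldsE) (simp add: * vf_in_vector_fields)
  \<comment> \<open>The chart is global, so constant coordinate vectors extend a tangent vector
    without any cutoff function.\<close>
  have "vf (\<lambda>_. u) \<in> vector_fields atlas" for u
    by (simp add: vf_in_vector_fields smooth_on_const open_U)
  then show "\<exists>X\<in>vector_fields atlas. \<exists>Y\<in>vector_fields atlas. \<exists>Z\<in>vector_fields atlas.
       X p = tv p x \<and> Y p = tv p y \<and> Z p = tv p z \<and> r = g p (curvature_operator atlas D X Y Z p) w"
    using *[of "\<lambda>_. x" "\<lambda>_. y" "\<lambda>_. z"]
    by (intro bexI[of _ "vf (\<lambda>_. x)"] bexI[of _ "vf (\<lambda>_. y)"] bexI[of _ "vf (\<lambda>_. z)"])
      (auto simp: vf_apply smooth_on_const open_U)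
qed

end

section \<open>A Weyl structure from its Taylor coefficients at a point\<close>

lemma bilinearD:
  assumes "bilinear f"
  shows "linear (f x)" "linear (\<lambda>x. f x y)"
  using assms by (simp_all add: bilinear_def)

lemma multilinear4D:
  assumes "multilinear4 A"
  shows "linear (\<lambda>x. A x y z w)" "linear (\<lambda>y. A x y z w)"
    "linear (\<lambda>z. A x y z w)" "linear (\<lambda>w. A x y z w)"
  using assms by (simp_all add: multilinear4_def)

lemma multilinear4_simps:
  assumes "multilinear4 A"
  shows "A (x + x') y z w = A x y z w + A x' y z w" "A (a *\<^sub>R x) y z w = a * A x y z w"
    "A x (y + y') z w = A x y z w + A x y' z w" "A x (a *\<^sub>R y) z w = a * A x y z w"
    "A x y (z + z') w = A x y z w + A x y z' w" "A x y (a *\<^sub>R z) w = a * A x y z w"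
    "A x y z (w + w') = A x y z w + A x y z w'" "A x y z (a *\<^sub>R w) = a * A x y z w"
    "A 0 y z w = 0" "A x 0 z w = 0" "A x y 0 w = 0" "A x y z 0 = 0"
  using assms by (simp_all add: multilinear4D[THEN linear_0]) (simp_all add: multilinear4_def linear_iff)

lemma bilinear_simps:
  fixes f :: "'a::real_vector \<Rightarrow> 'a \<Rightarrow> real"
  assumes "bilinear f"
  shows "f (x + x') y = f x y + f x' y" "f (a *\<^sub>R x) y = a * f x y"
    "f x (y + y') = f x y + f x y'" "f x (a *\<^sub>R y) = a * f x y"
    "f 0 y = 0" "f x 0 = 0"
  using assms by (simp_all add: bilinearD[THEN linear_0]) (simp_all add: bilinear_def linear_iff)

lemma smooth_on_bilinear:
  fixes f :: "'a::euclidean_space \<Rightarrow> 'a \<Rightarrow> real"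
  assumes "bilinear f" "open S" "smooth_on S a" "smooth_on S b"
  shows "smooth_on S (\<lambda>x. f (a x) (b x))"
  by (rule smooth_on_bounded_bilinear[OF assms(1)[unfolded bilinear_conv_bounded_bilinear] assms(2-4)])

lemma smooth_on_multilinear4:
  fixes Q :: "'a::euclidean_space \<Rightarrow> 'a \<Rightarrow> 'a \<Rightarrow> 'a \<Rightarrow> real"
  assumes Q: "multilinear4 Q" and S: "open S"
    and "smooth_on S a" "smooth_on S b" "smooth_on S u" "smooth_on S v"
  shows "smooth_on S (\<lambda>x. Q (a x) (b x) (u x) (v x))"
proof -
  have 1: "smooth_on S (\<lambda>x. Q (a x) b u v)" for b u v
    by (rule smooth_on_linear_apply[where F = "\<lambda>x a. Q a b u v" and Y = a])
      (intro S multilinear4D[OF Q] smooth_on_const assms)+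
  have 2: "smooth_on S (\<lambda>x. Q (a x) (b x) u v)" for u v
    by (rule smooth_on_linear_apply[where F = "\<lambda>x b. Q (a x) b u v" and Y = b])
      (intro S multilinear4D[OF Q] 1 assms)+
  have 3: "smooth_on S (\<lambda>x. Q (a x) (b x) (u x) v)" for v
    by (rule smooth_on_linear_apply[where F = "\<lambda>x u. Q (a x) (b x) u v" and Y = u])
      (intro S multilinear4D[OF Q] 2 assms)+
  show ?thesis
    by (rule smooth_on_linear_apply[where F = "\<lambda>x v. Q (a x) (b x) (u x) v" and Y = v])
      (intro S multilinear4D[OF Q] 3 assms)+
qed

text \<open>h and Q are the constant and the polarised quadratic Taylor coefficient of the metric at
  0, and \<psi> is the linear coefficient of the one-form. Symmetry of Q in its first two slots
  makes the derivative of Q x x equal to 2 Q v x; symmetry in the last two makes the metric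
  symmetric.\<close>

locale weyl_germ =
  fixes h \<psi> :: "real ^ 'n::finite \<Rightarrow> real ^ 'n \<Rightarrow> real"
    and Q :: "real ^ 'n \<Rightarrow> real ^ 'n \<Rightarrow> real ^ 'n \<Rightarrow> real ^ 'n \<Rightarrow> real"
  assumes h: "is_inner_product h"
    and bilinear_\<psi>: "bilinear \<psi>"
    and Q: "multilinear4 Q"
    and Q_commute_left: "Q a b u v = Q b a u v"
    and Q_commute_right: "Q a b u v = Q a b v u"
begin

lemma bilinear_h: "bilinear h" and h_commute: "h u v = h v u"
  using h by (simp_all add: is_inner_product_def)

lemmas multilinear_simps =
  bilinear_simps[OF bilinear_h] bilinear_simps[OF bilinear_\<psi>] multilinear4_simps[OF Q]

definition G :: "real ^ 'n \<Rightarrow> real ^ 'n \<Rightarrow> real ^ 'n \<Rightarrow> real" where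
  "G x u v = h u v + Q x x u v"

definition gram :: "real ^ 'n \<Rightarrow> real ^ 'n ^ 'n" where
  "gram x = (\<chi> i j. G x (axis i 1) (axis j 1))"

text \<open>Taking the full non-degeneracy locus avoids choosing a radius: it is open by continuity
  of the determinant and contains 0 because h is non-degenerate.\<close>

definition U :: "(real ^ 'n) set" where
  "U = {x. det (gram x) \<noteq> 0}"

text \<open>\<open>\<Lambda> x x u v w\<close> is the value that the Koszul formula and the term from \<open>\<phi>\<^sub>x = \<psi> x\<close> prescribe
  for \<open>G x (\<Gamma> x u v) w\<close>. The first argument splits off the linear dependence on the point, which is
  all that contributes to the derivative at \<open>0\<close>.\<close>

definition \<Lambda> :: "real ^ 'n \<Rightarrow> real ^ 'n \<Rightarrow> real ^ 'n \<Rightarrow> real ^ 'n \<Rightarrow> real ^ 'n \<Rightarrow> real" where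
  "\<Lambda> p x u v w = Q u p v w + Q v p u w - Q w p u v +
     \<psi> p u * G x v w + \<psi> p v * G x u w - \<psi> p w * G x u v"

text \<open>Cramer's rule for the linear system with matrix \<open>gram x\<close> and right-hand
  side \<Lambda>. As a quotient of determinants, the solution is visibly smooth in x wherever the
  denominator does not vanish.\<close>

definition \<Gamma> :: "real ^ 'n \<Rightarrow> real ^ 'n \<Rightarrow> real ^ 'n \<Rightarrow> real ^ 'n" where
  "\<Gamma> x u v = (\<chi> k. det (\<chi> i j. if j = k then \<Lambda> x x u v (axis i 1) else gram x $ i $ j) / det (gram x))"

lemma G_commute: "G x u v = G x v u"
  by (simp only: G_def h_commute[of u v] Q_commute_right[of x x u v])

lemma bilinear_G: "bilinear (G x)"
  by (auto simp: bilinear_def G_def linear_iff multilinear_simps algebra_simps)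

lemmas G_simps = bilinear_simps[OF bilinear_G]

lemma linear_\<Lambda>: "linear (\<lambda>p. \<Lambda> p x u v w)" "linear (\<lambda>w. \<Lambda> p x u v w)"
  by (auto simp: \<Lambda>_def linear_iff multilinear_simps G_simps algebra_simps)

lemma linear_eq_axis:
  fixes f g :: "real ^ 'n \<Rightarrow> real"
  assumes "linear f" "linear g" "\<And>i. f (axis i 1) = g (axis i 1)"
  shows "f w = g w"
proof -
  have "f b = g b" if "b \<in> Basis" for b
    using that assms(3) by (auto simp: Basis_vec_def)
  then have "f = g" by (rule linear_eq_stdbasis[OF assms(1,2)])
  then show ?thesis by simp
qed

lemma gram_mult: "(gram x *v u) $ i = G x u (axis i 1)"
proof -
  have "G x (axis i 1) u = (\<Sum>j\<in>UNIV. u $ j * G x (axis i 1) (axis j 1))"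
    using linear_sum[OF bilinearD(1)[OF bilinear_G], of x "axis i 1" "\<lambda>j. (u $ j) *\<^sub>R axis j 1" UNIV]
    by (simp add: basis_expansion[where 'a = real, unfolded scalar_mult_eq_scaleR] G_simps)
  then show ?thesis
    by (simp add: gram_def matrix_vector_mult_def G_commute[of x u] mult.commute)
qed

lemma U_iff: "x \<in> U \<longleftrightarrow> (\<forall>u. (\<forall>v. G x u v = 0) \<longrightarrow> u = 0)"
proof -
  have "gram x *v u = 0 \<longleftrightarrow> (\<forall>v. G x u v = 0)" for u
  proof
    assume "gram x *v u = 0"
    then have "G x u (axis i 1) = 0" for i
      by (simp flip: gram_mult)
    then show "\<forall>v. G x u v = 0"
      using linear_eq_axis[OF bilinearD(1)[OF bilinear_G] linear_zero] by simp
  qed (simp add: vec_eq_iff gram_mult)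
  moreover have "x \<in> U \<longleftrightarrow> (\<forall>u. gram x *v u = 0 \<longrightarrow> u = 0)"
    unfolding U_def mem_Collect_eq invertible_det_nz[symmetric] invertible_left_inverse
      matrix_left_invertible_ker ..
  ultimately show ?thesis by simp
qed

lemma zero_in_U: "0 \<in> U"
  using h by (simp add: U_iff G_def multilinear_simps is_inner_product_def)

lemma G_\<Gamma>:
  assumes "x \<in> U"
  shows "G x (\<Gamma> x u v) w = \<Lambda> x x u v w"
proof (rule linear_eq_axis[OF bilinearD(1)[OF bilinear_G] linear_\<Lambda>(2)])
  fix i :: 'n
  have "gram x *v \<Gamma> x u v = (\<chi> i. \<Lambda> x x u v (axis i 1))"
    using assms unfolding U_def by (subst cramer) (simp_all add: \<Gamma>_def cong: if_cong)
  then show "G x (\<Gamma> x u v) (axis i 1) = \<Lambda> x x u v (axis i 1)"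
    using gram_mult[of x "\<Gamma> x u v" i] by simp
qed

text \<open>By non-degeneracy of G x a vector is determined by its pairings. Bilinearity, symmetry
  and vanishing of \<Gamma> are thereby read off from \<Lambda>, without touching the
  determinants.\<close>

lemma \<Gamma>_eqI:
  assumes "x \<in> U" "\<And>w. G x a w = \<Lambda> x x u v w"
  shows "\<Gamma> x u v = a"
proof -
  have "G x (\<Gamma> x u v + (- 1) *\<^sub>R a) w = 0" for w
    by (simp only: G_simps G_\<Gamma>[OF assms(1)] assms(2))
  with assms(1) have "\<Gamma> x u v + (- 1) *\<^sub>R a = 0"
    unfolding U_iff by blast
  then show ?thesis by simp
qed

lemma \<Gamma>_0: "\<Gamma> 0 u v = 0"
  by (rule \<Gamma>_eqI[OF zero_in_U]) (simp add: \<Lambda>_def G_simps multilinear_simps)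

lemma smooth_on_G:
  assumes "open S" "smooth_on S u" "smooth_on S v"
  shows "smooth_on S (\<lambda>x. G x (u x) (v x))"
  unfolding G_def
  by (intro smooth_on_add smooth_on_bilinear[OF bilinear_h] smooth_on_multilinear4[OF Q]
      smooth_on_ident assms)

lemma smooth_on_\<Lambda>:
  assumes "open S" "smooth_on S p" "smooth_on S u" "smooth_on S v"
  shows "smooth_on S (\<lambda>x. \<Lambda> (p x) x (u x) (v x) w)"
  unfolding \<Lambda>_def
  by (intro smooth_on_add smooth_on_diff smooth_on_mult smooth_on_bilinear[OF bilinear_\<psi>]
      smooth_on_multilinear4[OF Q] smooth_on_G smooth_on_const assms)

lemma smooth_on_gram: "open S \<Longrightarrow> smooth_on S (\<lambda>x. gram x $ i $ j)"
  by (simp add: gram_def smooth_on_G smooth_on_const)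

lemma open_U: "open U"
proof -
  have "continuous_on UNIV (\<lambda>x. det (gram x))"
    by (intro smooth_on_imp_continuous_on smooth_on_det smooth_on_gram open_UNIV)
  from continuous_on_open_vimage[OF open_UNIV, THEN iffD1, OF this, rule_format, of "- {0}"]
  show ?thesis by (simp add: U_def vimage_def open_Compl)
qed

sublocale coordinate_connection U \<Gamma>
proof
  show "open U" by (rule open_U)
  show "bilinear (\<Gamma> p)" if p: "p \<in> U" for p
    unfolding bilinear_def linear_iff
    by (intro conjI allI; rule \<Gamma>_eqI[OF p])
      (simp_all add: G_simps G_\<Gamma>[OF p] \<Lambda>_def multilinear_simps algebra_simps)
  show "\<Gamma> p u v = \<Gamma> p v u" if p: "p \<in> U" for p u v
    by (rule \<Gamma>_eqI[OF p])
      (simp add: G_\<Gamma>[OF p] \<Lambda>_def G_commute[of p u v] Q_commute_right[of _ _ u v])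
  show "smooth_on U (\<lambda>x. \<Gamma> x (\<xi> x) (\<eta> x))" if "smooth_on U \<xi>" "smooth_on U \<eta>" for \<xi> \<eta>
  proof (rule smooth_on_vec[OF open_U])
    fix k
    have "smooth_on U (\<lambda>x. det (\<chi> i j. if j = k then \<Lambda> x x (\<xi> x) (\<eta> x) (axis i 1)
        else gram x $ i $ j) * inverse (det (gram x)))"
    proof (intro smooth_on_mult smooth_on_inverse smooth_on_det smooth_on_gram open_U)
      show "smooth_on U (\<lambda>x. (\<chi> i j. if j = k then \<Lambda> x x (\<xi> x) (\<eta> x) (axis i 1)
        else gram x $ i $ j) $ i $ j)" for i j
        by (cases "j = k")
          (simp_all add: smooth_on_\<Lambda> smooth_on_gram smooth_on_ident open_U that)
    qed (simp add: U_def)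
    then show "smooth_on U (\<lambda>x. \<Gamma> x (\<xi> x) (\<eta> x) $ k)"
      by (simp add: \<Gamma>_def divide_inverse)
  qed
qed

lemma has_derivative_G:
  assumes \<eta>: "(\<eta> has_derivative \<eta>') (at p)" and \<zeta>: "(\<zeta> has_derivative \<zeta>') (at p)"
  shows "((\<lambda>x. G x (\<eta> x) (\<zeta> x)) has_derivative
    (\<lambda>v. G p (\<eta> p) (\<zeta>' v) + (G p (\<eta>' v) (\<zeta> p) + 2 * Q v p (\<eta> p) (\<zeta> p)))) (at p)"
proof -
  have 0: "((\<lambda>x. G x u w) has_derivative (\<lambda>v. 2 * Q v p u w)) (at p)" for u w
  proof -
    have "bounded_bilinear (\<lambda>a b. Q a b u w)"
      unfolding bilinear_conv_bounded_bilinear[symmetric] bilinear_def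
      using multilinear4D[OF Q] by simp
    from bounded_bilinear.FDERIV[OF this has_derivative_ident has_derivative_ident]
    show ?thesis
      unfolding G_def by (auto intro!: derivative_eq_intros simp: Q_commute_left[of p])
  qed
  have 1: "((\<lambda>x. G x (\<eta> x) w) has_derivative
      (\<lambda>v. G p (\<eta>' v) w + 2 * Q v p (\<eta> p) w)) (at p)" for w
    by (rule has_derivative_linear_apply[where F = "\<lambda>x u. G x u w" and Y = \<eta> and S = UNIV
          and F' = "\<lambda>v u. 2 * Q v p u w"])
      (rule open_UNIV UNIV_I bilinearD[OF bilinear_G] 0 \<eta>)+
  show ?thesis
    by (rule has_derivative_linear_apply[where F = "\<lambda>x w. G x (\<eta> x) w" and Y = \<zeta> and S = UNIV
          and F' = "\<lambda>v w. G p (\<eta>' v) w + 2 * Q v p (\<eta> p) w"])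
      (rule open_UNIV UNIV_I bilinearD[OF bilinear_G] 1 \<zeta>)+
qed

text \<open>Instead of Cramer's quotient, the identity G x (\<Gamma> x u v) w = \<Lambda> x x u v w
  is differentiated at 0. On the left \<Gamma> vanishes and G 0 = h. On the right \<Lambda> is
  linear in its first argument, which is 0 there, so only that argument is differentiated. The
  derivatives of \<eta> and \<zeta> never enter, which makes the result independent of the
  extensions.\<close>

lemma h_frechet_\<Gamma>:
  assumes \<eta>: "smooth_on U \<eta>" and \<zeta>: "smooth_on U \<zeta>"
  shows "h (frechet_derivative (\<lambda>x. \<Gamma> x (\<eta> x) (\<zeta> x)) (at 0) v) w = \<Lambda> v 0 (\<eta> 0) (\<zeta> 0) w"
proof -
  let ?E = "\<lambda>x. \<Gamma> x (\<eta> x) (\<zeta> x)"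
  have E: "(?E has_derivative frechet_derivative ?E (at 0)) (at 0)"
    by (rule smooth_on_has_derivative[OF smooth_\<Gamma>[OF assms] zero_in_U])
  have "((\<lambda>x. \<Lambda> u x (\<eta> x) (\<zeta> x) w) has_derivative
      frechet_derivative (\<lambda>x. \<Lambda> u x (\<eta> x) (\<zeta> x) w) (at 0)) (at 0)" for u
    by (rule smooth_on_has_derivative[OF _ zero_in_U])
      (intro smooth_on_\<Lambda> smooth_on_const open_U assms)
  then have "((\<lambda>x. \<Lambda> x x (\<eta> x) (\<zeta> x) w) has_derivative (\<lambda>v. \<Lambda> v 0 (\<eta> 0) (\<zeta> 0) w +
      frechet_derivative (\<lambda>x. \<Lambda> 0 x (\<eta> x) (\<zeta> x) w) (at 0) v)) (at 0)"
    by (intro has_derivative_linear_apply[where F = "\<lambda>x p. \<Lambda> p x (\<eta> x) (\<zeta> x) w" and S = UNIV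
          and F' = "\<lambda>v u. frechet_derivative (\<lambda>x. \<Lambda> u x (\<eta> x) (\<zeta> x) w) (at 0) v"
          and Y = "\<lambda>x. x"] open_UNIV UNIV_I linear_\<Lambda>(1) has_derivative_ident)
  \<comment> \<open>The derivative left implicit so far is that of \<Lambda> with first argument 0,
    a function that is identically zero.\<close>
  then have "((\<lambda>x. \<Lambda> x x (\<eta> x) (\<zeta> x) w) has_derivative (\<lambda>v. \<Lambda> v 0 (\<eta> 0) (\<zeta> 0) w)) (at 0)"
    by (simp add: linear_0[OF linear_\<Lambda>(1)])
  then have "((\<lambda>x. G x (?E x) w) has_derivative (\<lambda>v. \<Lambda> v 0 (\<eta> 0) (\<zeta> 0) w)) (at 0)"
    by (rule has_derivative_transform_within_open[OF _ open_U zero_in_U]) (simp add: G_\<Gamma>)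
  from has_derivative_unique[OF this has_derivative_G[OF E has_derivative_const]]
  have "\<Lambda> v 0 (\<eta> 0) (\<zeta> 0) w = G 0 (frechet_derivative ?E (at 0) v) w"
    by (simp add: fun_eq_iff G_simps multilinear_simps)
  then show ?thesis by (simp add: G_def multilinear_simps)
qed

section \<open>The Weyl structure and its curvature at the origin\<close>

definition metric :: "real ^ 'n \<Rightarrow> (real ^ 'n, 'n) tvec \<Rightarrow> (real ^ 'n, 'n) tvec \<Rightarrow> real" where
  "metric p u v = G p (u coord) (v coord)"

lemma metric_tv: "p \<in> U \<Longrightarrow> metric p (tv p u) (tv p v) = G p u v"
  by (simp add: metric_def)

lemma smooth_metric:
  assumes "smooth_on U \<eta>" "smooth_on U \<zeta>"
  shows "smooth_on U (\<lambda>p. metric p (vf \<eta> p) (vf \<zeta> p))"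
  using smooth_on_cong[OF open_U, of "\<lambda>p. metric p (vf \<eta> p) (vf \<zeta> p)"] smooth_on_G[OF open_U assms]
  by (simp add: vf_apply metric_tv)

lemma pseudo_riemannian_metric: "pseudo_riemannian_metric atlas metric"
  unfolding pseudo_riemannian_metric_def
proof (intro conjI ballI allI impI)
  fix p u v w a
  assume "p \<in> points atlas" "u \<in> tangent_space atlas p"
  then have p: "p \<in> U" and u: "u = tv p (u coord)" by (simp_all add: tangent_space_iff)
  show "metric p u v = metric p v u"
    unfolding metric_def by (rule G_commute)
  show "metric p (tv_add u v) w = metric p u w + metric p v w"
    "metric p (tv_scale a u) w = a * metric p u w"
    by (simp_all add: metric_def tv_add_def tv_scale_def G_simps)
  assume zero: "\<forall>v\<in>tangent_space atlas p. metric p u v = 0"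
  have "G p (u coord) v = 0" for v
    using zero[rule_format, OF tv_in_tangent_space[of p v]] p by (simp add: metric_def)
  then have "u coord = 0" using p by (simp add: U_iff)
  then show "u = (\<lambda>c. 0)" by (subst u) (simp add: tv_def)
next
  fix X Y assume "X \<in> vector_fields atlas" "Y \<in> vector_fields atlas"
  then show "(\<lambda>p. metric p (X p) (Y p)) \<in> smooth_functions atlas"
    by (elim vector_fieldsE) (simp add: smooth_functions_iff smooth_metric)
qed

lemma one_form: "one_form atlas (\<lambda>p u. \<psi> p (u coord))"
  unfolding one_form_def
proof (intro conjI ballI allI)
  fix X assume "X \<in> vector_fields atlas"
  then obtain \<xi> where "X = vf \<xi>" and \<xi>: "smooth_on U \<xi>" by (rule vector_fieldsE)
  then show "(\<lambda>p. \<psi> p (X p coord)) \<in> smooth_functions atlas"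
    using smooth_on_cong[OF open_U, of "\<lambda>p. \<psi> p (X p coord)"]
      smooth_on_bilinear[OF bilinear_\<psi> open_U smooth_on_ident[OF open_U] \<xi>]
    by (simp add: smooth_functions_iff vf_coord)
qed (simp_all add: tv_add_def tv_scale_def multilinear_simps)

text \<open>In \<Lambda> p p \<xi> \<eta> \<zeta> + \<Lambda> p p \<xi> \<zeta> \<eta> the last two
  Q terms and the last two \<psi> terms are skew in \<eta> and \<zeta> and cancel. The first Q terms
  add up to the derivative of the metric, and the first \<psi> terms to 2 \<psi> p \<xi> G p \<eta>
  \<zeta>.\<close>

lemma nabla_metric_D:
  assumes "smooth_on U \<xi>" "smooth_on U \<eta>" "smooth_on U \<zeta>" and p: "p \<in> U"
  shows "nabla_metric atlas metric D (vf \<xi>) (vf \<eta>) (vf \<zeta>) p =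
    - 2 * \<psi> p (\<xi> p) * G p (\<eta> p) (\<zeta> p)"
proof -
  note \<eta> = smooth_on_has_derivative[OF assms(2) p]
  note \<zeta> = smooth_on_has_derivative[OF assms(3) p]
  have "frechet_derivative (\<lambda>q. metric q (vf \<eta> q) (vf \<zeta> q)) (at p) =
      frechet_derivative (\<lambda>q. G q (\<eta> q) (\<zeta> q)) (at p)"
    by (rule frechet_derivative_cong_open[OF open_U p]) (simp add: vf_apply metric_tv)
  then have "nabla_metric atlas metric D (vf \<xi>) (vf \<eta>) (vf \<zeta>) p =
      2 * Q (\<xi> p) p (\<eta> p) (\<zeta> p) - G p (\<Gamma> p (\<xi> p) (\<eta> p)) (\<zeta> p) - G p (\<Gamma> p (\<xi> p) (\<zeta> p)) (\<eta> p)"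
    by (simp add: nabla_metric_def vf_deriv_vf[OF p] D_vf vf_apply metric_tv[OF p] G_simps
        frechet_derivative_at[OF has_derivative_G[OF \<eta> \<zeta>], symmetric]
        G_commute[of p "\<eta> p" "\<Gamma> p (\<xi> p) (\<zeta> p)"])
  also have "\<dots> = - 2 * \<psi> p (\<xi> p) * G p (\<eta> p) (\<zeta> p)"
    unfolding G_\<Gamma>[OF p] \<Lambda>_def G_commute[of p "\<zeta> p" "\<eta> p"] G_commute[of p "\<zeta> p" "\<xi> p"]
      Q_commute_right[of "\<xi> p" p "\<zeta> p" "\<eta> p"] Q_commute_right[of _ p "\<zeta> p" "\<xi> p"]
      Q_commute_right[of _ p "\<eta> p" "\<xi> p"] G_commute[of p "\<eta> p" "\<xi> p"]
    by (simp add: algebra_simps)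
  finally show ?thesis .
qed

lemma weyl_manifold:
  assumes "CARD('n) \<ge> 2"
  shows "weyl_manifold (top_of_set U) atlas metric D"
  unfolding weyl_manifold_def
proof (intro conjI assms smooth_manifold_atlas pseudo_riemannian_metric connection_D torsion_free_D
    exI[of _ "\<lambda>p u. \<psi> p (u coord)"] one_form ballI)
  fix X Y Z p
  assume "X \<in> vector_fields atlas" "Y \<in> vector_fields atlas" "Z \<in> vector_fields atlas"
    and "p \<in> points atlas"
  then show "nabla_metric atlas metric D X Y Z p =
      - 2 * \<psi> p (X p coord) * metric p (Y p) (Z p)"
    by (elim vector_fieldsE) (simp add: nabla_metric_D vf_apply metric_tv)
qed

lemma curvature_tensor_0:
  "curvature_tensor atlas metric D 0 (tv 0 x) (tv 0 y) (tv 0 z) (tv 0 w) =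
    \<Lambda> x 0 y z w - \<Lambda> y 0 x z w"
proof (rule curvature_tensor_eqI[OF zero_in_U \<Gamma>_0])
  fix \<xi> \<eta> \<zeta> assume "smooth_on U \<xi>" "smooth_on U \<eta>" "smooth_on U \<zeta>" "\<xi> 0 = x" "\<eta> 0 = y" "\<zeta> 0 = z"
  then show "metric 0 (tv 0 (frechet_derivative (\<lambda>x. \<Gamma> x (\<eta> x) (\<zeta> x)) (at 0) x -
      frechet_derivative (\<lambda>x. \<Gamma> x (\<xi> x) (\<zeta> x)) (at 0) y)) (tv 0 w) = \<Lambda> x 0 y z w - \<Lambda> y 0 x z w"
    by (simp add: metric_tv[OF zero_in_U] G_def multilinear_simps h_frechet_\<Gamma>
        linear_diff[OF bilinearD(2)[OF bilinear_h]])
qed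

end

section \<open>Decomposition of Weyl curvature tensors\<close>

text \<open>There are four cyclic sums, one for each choice of last argument. Adding the first two
  and subtracting the other two, everything cancels by skew symmetry except 2 B x y z w - 2 B z w x
  y.\<close>

lemma algebraic_curvature_pair_symmetry:
  fixes B :: "'a \<Rightarrow> 'a \<Rightarrow> 'a \<Rightarrow> 'a \<Rightarrow> real"
  assumes skew: "\<And>x y z w. B x y z w = - B y x z w" "\<And>x y z w. B x y z w = - B x y w z"
    and bianchi: "\<And>x y z w. B x y z w + B y z x w + B z x y w = 0"
  shows "B x y z w = B z w x y"
  using bianchi[of x y z w] bianchi[of y z w x] bianchi[of z w x y] bianchi[of w x y z]
    skew(1)[of z x y w] skew(2)[of x z y w] skew(1)[of w y z x] skew(2)[of y w z x]
    skew(1)[of x w y z] skew(2)[of y z w x] skew(2)[of x y z w] skew(2)[of z w x y]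
    skew(1)[of w x y z] skew(2)[of x w y z] skew(1)[of w x z y] skew(2)[of w x z y]
    skew(1)[of z y x w] skew(2)[of y z x w] skew(2)[of w y x z] skew(1)[of y w x z]
    skew(2)[of z x y w] skew(2)[of w y z x]
  by linarith

text \<open>The Ricci tensor enters only as an unspecified function c. One pair with nonzero inner
  product suffices to recover c from A, so \<psi> inherits bilinearity and skew symmetry from A and
  no trace has to be computed.\<close>

lemma weyl_curvature_decomposition:
  fixes h :: "'v::real_vector \<Rightarrow> 'v \<Rightarrow> real"
  assumes "bilinear h" and h_commute: "\<And>x y. h x y = h y x" and "h z\<^sub>0 w\<^sub>0 \<noteq> 0"
    and A: "multilinear4 A"
    and skew: "\<And>x y z w. A x y z w + A y x z w = 0"
    and bianchi: "\<And>x y z w. A x y z w + A y z x w + A z x y w = 0"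
    and weyl: "\<And>x y z w. A x y z w + A x y w z = c x y * h z w"
  obtains Q \<psi> where "multilinear4 Q" "bilinear \<psi>"
    "\<And>a b u v. Q a b u v = Q b a u v" "\<And>a b u v. Q a b u v = Q a b v u"
    "\<And>x y z w. A x y z w =
      (Q y x z w + Q z x y w - Q w x y z + \<psi> x y * h z w + \<psi> x z * h y w - \<psi> x w * h y z) -
      (Q x y z w + Q z y x w - Q w y x z + \<psi> y x * h z w + \<psi> y z * h x w - \<psi> y w * h x z)"
proof -
  define \<psi> where "\<psi> x y = (A x y z\<^sub>0 w\<^sub>0 + A x y w\<^sub>0 z\<^sub>0) / (4 * h z\<^sub>0 w\<^sub>0)" for x y
  have \<psi>: "bilinear \<psi>"
    by (auto simp: bilinear_def linear_iff \<psi>_def multilinear4_simps[OF A] add_divide_distrib ring_distribs)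
  have c: "c x y = 4 * \<psi> x y" for x y
    using weyl[of x y z\<^sub>0 w\<^sub>0] \<open>h z\<^sub>0 w\<^sub>0 \<noteq> 0\<close> by (simp add: \<psi>_def)
  have \<psi>_skew: "\<psi> x y = - \<psi> y x" for x y
    using skew[of x y z\<^sub>0 w\<^sub>0] skew[of x y w\<^sub>0 z\<^sub>0] unfolding \<psi>_def
    by (simp add: add_eq_0_iff2 minus_divide_left)
  \<comment> \<open>The subtracted tensor is the curvature at 0 produced by \<psi> over the flat
    metric h. It satisfies the Bianchi identity because \<psi> is alternating, and its symmetric
    part in z, w is that of A, so the remainder is skew there.\<close>
  define B where "B x y z w = A x y z w - (2 * \<psi> x y * h z w + \<psi> x z * h y w - h y z * \<psi> x w -
    \<psi> y z * h x w + h x z * \<psi> y w)" for x y z w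
  \<comment> \<open>\<open>Q x x u v = - B x u v x / 3\<close>, the second order term in normal coordinates of a metric with
    curvature \<open>B\<close>\<close>
  define Q where "Q a b u v = - (B a u v b + B b u v a) / 6" for a b u v
  have Q_eq: "6 * Q a b u v = - B a u v b - B b u v a" for a b u v
    by (simp add: Q_def)
  have B_skew1: "B x y z w = - B y x z w" for x y z w
    using skew[of x y z w] \<psi>_skew[of x y] unfolding B_def by (simp add: algebra_simps)
  have B_skew2: "B x y z w = - B x y w z" for x y z w
    using weyl[of x y z w] h_commute[of z w] unfolding B_def c by (simp add: algebra_simps)
  have B_bianchi: "B x y z w + B y z x w + B z x y w = 0" for x y z w
    using bianchi[of x y z w] \<psi>_skew[of y x] \<psi>_skew[of z y] \<psi>_skew[of z x]
      h_commute[of y x] h_commute[of z y] h_commute[of z x]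
    unfolding B_def by (simp add: algebra_simps)
  have B_pair: "B x y z w = B z w x y" for x y z w
    by (rule algebraic_curvature_pair_symmetry[of B]) (rule B_skew1 B_skew2 B_bianchi)+
  show thesis
  proof
    show "bilinear \<psi>" by (rule \<psi>)
    have B: "multilinear4 B"
      by (auto simp: multilinear4_def linear_iff B_def multilinear4_simps[OF A]
          bilinear_simps[OF \<open>bilinear h\<close>] bilinear_simps[OF \<psi>] algebra_simps)
    show "multilinear4 Q"
      by (auto simp: multilinear4_def linear_iff Q_def multilinear4_simps[OF B] algebra_simps
          add_divide_distrib diff_divide_distrib)
    show "Q a b u v = Q b a u v" for a b u v
      by (simp add: Q_def)
    \<comment> \<open>Exchanging u and v therefore swaps the two summands of Q.\<close>
    have "B a u v b = B b v u a" for a b u v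
      using B_pair[of a u v b] B_skew1[of v b a u] B_skew2[of b v a u] by linarith
    then show "Q a b u v = Q a b v u" for a b u v
      unfolding Q_def by (metis add.commute)
    fix x y z w
    \<comment> \<open>The outer terms Q y x z w and Q x y z w cancel. After multiplication by 6,
      four of the eight remaining B terms are B x y z w up to skew symmetry; by pair symmetry the
      other four are -2 times the rest of its cyclic sum, which is 2 B x y z w. This accounts for
      the divisor 6.\<close>
    have "B x y z w = Q y x z w + Q z x y w - Q w x y z - (Q x y z w + Q z y x w - Q w y x z)"
      using B_skew2[of x y w z] B_skew1[of y x z w] B_skew1[of y x w z] B_skew1[of z y w x]
        B_skew2[of y z w x] B_pair[of w y z x] B_skew2[of z x w y] B_pair[of w x z y]
        B_bianchi[of x y z w]
        Q_eq[of y x z w] Q_eq[of z x y w] Q_eq[of w x y z] Q_eq[of x y z w] Q_eq[of z y x w]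
        Q_eq[of w y x z]
      by linarith
    then show "A x y z w =
      (Q y x z w + Q z x y w - Q w x y z + \<psi> x y * h z w + \<psi> x z * h y w - \<psi> x w * h y z) -
      (Q x y z w + Q z y x w - Q w y x z + \<psi> y x * h z w + \<psi> y z * h x w - \<psi> y w * h x z)"
      using \<psi>_skew[of y x] unfolding B_def[of x y z w] by (simp add: algebra_simps)
  qed
qed

lemma linear_isomorphism_exists:
  assumes dim: "dim (UNIV :: 'v::real_vector set) = DIM('a::euclidean_space)"
  obtains L :: "'v::real_vector \<Rightarrow> 'a::euclidean_space" where "linear L" "bij L"
proof (rule basis_exists[of "UNIV :: 'v set"])
  fix B :: "'v set"
  assume B: "B \<subseteq> UNIV" "independent B" "UNIV \<subseteq> span B" "card B = dim (UNIV :: 'v set)"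
  have dim': "dim (UNIV :: 'v set) = dim (UNIV :: 'a set)" using dim by (simp only: dim_UNIV)
  \<comment> \<open>An infinite set has cardinality 0, so positivity of the dimension is what
    excludes an infinite basis.\<close>
  have "card B > 0" using B(4) dim DIM_positive[where 'a = 'a] by linarith
  then have "finite B" by (rule card_ge_0_finite)
  have "card (Basis :: 'a set) = dim (UNIV :: 'a set)" by (simp only: dim_UNIV)
  moreover have "UNIV \<subseteq> span (Basis :: 'a set)" by (simp only: span_Basis subset_UNIV)
  ultimately have "\<exists>L :: 'v \<Rightarrow> 'a. linear L \<and> L ` B = Basis \<and> L ` UNIV = UNIV \<and> inj L"
    by (intro finite_basis_to_basis_subspace_isomorphism[OF subspace_UNIV subspace_UNIV dim'
          \<open>finite B\<close> B finite_Basis subset_UNIV independent_Basis])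
  then obtain L :: "'v \<Rightarrow> 'a" where L: "linear L" "range L = UNIV" "inj L" by (elim exE conjE)
  from L(2,3) have "bij L" by (simp only: bij_def simp_thms)
  with L(1) show thesis by (rule that)
qed

text \<open>The type of V carries no topology, so the manifold lives in coordinates. The
  decomposition is carried out in V, where the Ricci tensor is defined, and only its ingredients h,
  \<psi> and Q are moved by the inverse K of L; thus \<open>ricci\<close> is never
  transported.\<close>

theorem theorem3:
  fixes h :: "'v::real_vector \<Rightarrow> 'v \<Rightarrow> real"
    and A :: "'v \<Rightarrow> 'v \<Rightarrow> 'v \<Rightarrow> 'v \<Rightarrow> real"
  assumes "dim (UNIV :: 'v set) = CARD('n::finite)"
    and "CARD('n) \<ge> 2"
    and "is_inner_product h"
    and "A \<in> weyl_curvature_tensors h"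
  shows "\<exists>(T :: (real ^ 'n) topology) (\<A> :: (real ^ 'n, 'n) chart set) g D P
            (\<Xi> :: 'v \<Rightarrow> (real ^ 'n, 'n) tvec).
     weyl_manifold T \<A> g D \<and> P \<in> points \<A> \<and> tangent_isomorphism \<A> P \<Xi> \<and>
     (\<forall>x y. g P (\<Xi> x) (\<Xi> y) = h x y) \<and>
     (\<forall>x y z w. curvature_tensor \<A> g D P (\<Xi> x) (\<Xi> y) (\<Xi> z) (\<Xi> w) = A x y z w)"
proof -
  have "dim (UNIV :: 'v set) = DIM(real ^ 'n)" using assms(1) by simp
  then obtain L :: "'v \<Rightarrow> real ^ 'n" where L: "linear L" "bij L"
    by (rule linear_isomorphism_exists)
  define K where "K = inv L"
  have KL: "K (L x) = x" for x
    by (simp add: K_def bij_is_inj[OF L(2)])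
  have LK: "L (K u) = u" for u
    by (simp add: K_def bij_is_surj[OF L(2)] surj_f_inv_f)
  have K_add: "K (u + v) = K u + K v" and K_scale: "K (a *\<^sub>R u) = a *\<^sub>R K u" for a u v
    using KL[of "K u + K v"] KL[of "a *\<^sub>R K u"]
    by (simp_all add: LK linear_add[OF L(1)] linear_scale[OF L(1)])
  have h: "bilinear h" "\<And>x y. h x y = h y x" "\<And>x. (\<And>y. h x y = 0) \<Longrightarrow> x = 0"
    using assms(3) by (simp_all add: is_inner_product_def)
  \<comment> \<open>If h vanished identically, non-degeneracy would make V trivial, against its
    positive dimension.\<close>
  have "\<exists>z w. h z w \<noteq> 0"
  proof (rule ccontr)
    assume "\<nexists>z w. h z w \<noteq> 0"
    then have "K u = 0" for u using h(3) by blast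
    then have "(axis i 1 :: real ^ 'n) = 0" for i
      using LK[of "axis i 1"] linear_0[OF L(1)] by simp
    then show False by simp
  qed
  then obtain z\<^sub>0 w\<^sub>0 where "h z\<^sub>0 w\<^sub>0 \<noteq> 0" by blast
  moreover have A: "multilinear4 A" "A x y z w + A y x z w = 0"
    "A x y z w + A y z x w + A z x y w = 0"
    "A x y z w + A x y w z =
      2 / real (dim (UNIV :: 'v set)) * (ricci h A y x - ricci h A x y) * h z w" for x y z w
    using assms(4) unfolding weyl_curvature_tensors_def by blast+
  ultimately obtain Q \<psi> where Q: "multilinear4 Q" and \<psi>: "bilinear \<psi>"
    and Q_commute: "\<And>a b u v. Q a b u v = Q b a u v" "\<And>a b u v. Q a b u v = Q a b v u"
    and A_eq: "\<And>x y z w. A x y z w =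
      (Q y x z w + Q z x y w - Q w x y z + \<psi> x y * h z w + \<psi> x z * h y w - \<psi> x w * h y z) -
      (Q x y z w + Q z y x w - Q w y x z + \<psi> y x * h z w + \<psi> y z * h x w - \<psi> y w * h x z)"
    using weyl_curvature_decomposition[where
        c = "\<lambda>x y. 2 / real (dim (UNIV :: 'v set)) * (ricci h A y x - ricci h A x y)",
        OF h(1,2) _ A]
    by blast
  interpret W: weyl_germ "\<lambda>u v. h (K u) (K v)" "\<lambda>u v. \<psi> (K u) (K v)"
    "\<lambda>a b u v. Q (K a) (K b) (K u) (K v)"
  proof
    have "u = 0" if "\<forall>v. h (K u) (K v) = 0" for u
    proof -
      have "h (K u) y = 0" for y using that[rule_format, of "L y"] by (simp add: KL)
      then have "K u = 0" by (rule h(3))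
      then show "u = 0" using LK[of u] linear_0[OF L(1)] by simp
    qed
    then show "is_inner_product (\<lambda>u v. h (K u) (K v))"
      unfolding is_inner_product_def using h(2)
      by (auto simp: bilinear_def linear_iff K_add K_scale bilinear_simps[OF h(1)])
    show "bilinear (\<lambda>u v. \<psi> (K u) (K v))"
      by (simp add: bilinear_def linear_iff K_add K_scale bilinear_simps[OF \<psi>])
    show "multilinear4 (\<lambda>a b u v. Q (K a) (K b) (K u) (K v))"
      by (simp add: multilinear4_def linear_iff K_add K_scale multilinear4_simps[OF Q])
  qed (rule Q_commute)+
  have "K 0 = 0" using K_scale[of 0 0] by simp
  show ?thesis
  proof (intro exI conjI allI)
    show "weyl_manifold (top_of_set W.U) W.atlas W.metric W.D"
      by (rule W.weyl_manifold[OF assms(2)])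
    show "0 \<in> points W.atlas" by (simp add: W.zero_in_U)
    show "tangent_isomorphism W.atlas 0 (\<lambda>x. W.tv 0 (L x))"
      by (rule W.tangent_isomorphism_tv[OF W.zero_in_U L])
    show "W.metric 0 (W.tv 0 (L x)) (W.tv 0 (L y)) = h x y" for x y
      by (simp add: W.metric_tv[OF W.zero_in_U] W.G_def KL \<open>K 0 = 0\<close> multilinear4_simps[OF Q])
    show "curvature_tensor W.atlas W.metric W.D 0 (W.tv 0 (L x)) (W.tv 0 (L y)) (W.tv 0 (L z))
        (W.tv 0 (L w)) = A x y z w" for x y z w
      by (simp add: W.curvature_tensor_0 W.\<Lambda>_def W.G_def KL \<open>K 0 = 0\<close> multilinear4_simps[OF Q] A_eq[of x y z w])
  qed
qed

end
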